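(* Let $A$ be an operator in a Hilbert space $H$ as described in the context. For $x\in D(A)$, $$\log_\theta\!A\,x-\log_\varphi\!A\,x=\int_{\Gamma_{\theta,\varphi}}\lambda^{-1}A(A-\lambda)^{-1}x\,d\lambda=-2\pi i\;\Pi_{\theta,\varphi}(A)\,x.$$ When $\Pi_{\theta,\varphi}(A)$ is bounded, so is $\log_\theta\!A-\log_\varphi\!A$, and $$\Pi_{\theta,\varphi}(A)=\frac{i}{2\pi}\big(\log_\theta\!A-\log_\varphi\!A\big).$$
   Context: $A$ is an unbounded, densely defined, closed operator in a Hilbert space $H$ with domain $D(A)$. For some $\theta<\varphi<\theta+2\pi$, the resolvent set of $A$ contains two sectors $V_\theta$ and $V_\varphi$ around $e^{i\theta}\mathbb R_+$ and $e^{i\varphi}\mathbb R_+$, respectively; the resolvent $(A-\lambda)^{-1}$ is compact; and $\|(A-\lambda)^{-1}\|$ is $O(\lambda^{-1})$ for $\lambda\to\infty$ on each ray of these sectors. $r_0>0$ is taken so small that $0$ is the only possible eigenvalue of $A$ of modulus at most $r_0$. The sectorial projection $\Pi_{\theta,\varphi}(A)$ is defined, with domain $D(A)$ to begin with, by $$\Pi_{\theta,\varphi}(A)x=\frac{i}{2\pi}\int_{\Gamma_{\theta,\varphi}}\lambda^{-1}A(A-\lambda)^{-1}x\,d\lambda,\quad x\in D(A),$$ where the contour is $\Gamma_{\theta,\varphi}=\{re^{i\varphi}:\infty>r>r_0\}\cup\{r_0e^{i\omega}:\varphi\ge\omega\ge\theta\}\cup\{re^{i\theta}:r_0<r<\infty\}$,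 traversed in this order; if it is bounded in $H$-norm it is extended by continuity to $H$ (and so is $\log_\theta A-\log_\varphi A$ when bounded on $D(A)$). The logarithm with branch cut at the angle $\theta$ is defined for $x\in D(A)$ by $$\log_\theta\!A\,x=\lim_{s\searrow0}\frac{i}{2\pi}\int_{\mathcal C_\theta}\lambda_\theta^{-s}\log_\theta\!\lambda\,(A-\lambda)^{-1}x\,d\lambda,$$ where $\mathcal C_\theta=\{re^{i\theta}:\infty>r>r_0\}\cup\{r_0e^{i\omega}:\theta\ge\omega\ge\theta-2\pi\}\cup\{re^{i(\theta-2\pi)}:r_0<r<\infty\}$, traversed in this order, and $\log_\theta\lambda=\log r+i\omega$, $\lambda_\theta^{-s}=e^{-s\log_\theta\lambda}$ for $\lambda=re^{i\omega}$ with $\theta-2\pi\le\omega\le\theta$ (the two values on the cut being used on the respective edges of the contour). $\log_\varphi A$ is defined in the same way with $\theta$ replaced by $\varphi$. *)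

theory Defs
  imports "HOL-Analysis.Analysis" "HOL-Library.Landau_Symbols"
begin

class complex_hilbert_space = banach +
  fixes scaleC :: "complex \<Rightarrow> 'a \<Rightarrow> 'a" (infixr "*\<^sub>C" 75)
    and cinner :: "'a \<Rightarrow> 'a \<Rightarrow> complex"
  assumes scaleC_add_right: "a *\<^sub>C (x + y) = a *\<^sub>C x + a *\<^sub>C y"
    and scaleC_add_left: "(a + b) *\<^sub>C x = a *\<^sub>C x + b *\<^sub>C x"
    and scaleC_scaleC: "a *\<^sub>C b *\<^sub>C x = (a * b) *\<^sub>C x"
    and scaleC_of_real: "complex_of_real r *\<^sub>C x = r *\<^sub>R x"
    and cinner_commute: "cinner x y = cnj (cinner y x)"
    and cinner_add_left: "cinner (x + y) z = cinner x z + cinner y z"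
    and cinner_scaleC_left: "cinner (a *\<^sub>C x) y = a * cinner x y"
    and cinner_self: "cinner x x = complex_of_real ((norm x)\<^sup>2)"

text \<open>An operator in \<open>H\<close> is given by its domain \<open>D\<close> and a total function \<open>A\<close> of which
  only the values on \<open>D\<close> are relevant.  As usual, ``unbounded operator'' means that no
  boundedness is required.\<close>

definition clinear_operator :: "'h::complex_hilbert_space set \<Rightarrow> ('h \<Rightarrow> 'h) \<Rightarrow> bool" where
  "clinear_operator D A \<longleftrightarrow>
     0 \<in> D \<and> (\<forall>x\<in>D. \<forall>y\<in>D. x + y \<in> D \<and> A (x + y) = A x + A y) \<and>
     (\<forall>c. \<forall>x\<in>D. c *\<^sub>C x \<in> D \<and> A (c *\<^sub>C x) = c *\<^sub>C A x)"

definition densely_defined :: "'h::complex_hilbert_space set \<Rightarrow> bool" where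
  "densely_defined D \<longleftrightarrow> closure D = UNIV"

definition closed_operator :: "'h::complex_hilbert_space set \<Rightarrow> ('h \<Rightarrow> 'h) \<Rightarrow> bool" where
  "closed_operator D A \<longleftrightarrow> closed ((\<lambda>x. (x, A x)) ` D)"

definition eigenvalue :: "'h::complex_hilbert_space set \<Rightarrow> ('h \<Rightarrow> 'h) \<Rightarrow> complex \<Rightarrow> bool" where
  "eigenvalue D A \<mu> \<longleftrightarrow> (\<exists>x\<in>D. x \<noteq> 0 \<and> A x = \<mu> *\<^sub>C x)"

definition resolvent :: "'h::complex_hilbert_space set \<Rightarrow> ('h \<Rightarrow> 'h) \<Rightarrow> complex \<Rightarrow> 'h \<Rightarrow> 'h" where
  "resolvent D A \<mu> = inv_into D (\<lambda>x. A x - \<mu> *\<^sub>C x)"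

definition resolvent_set :: "'h::complex_hilbert_space set \<Rightarrow> ('h \<Rightarrow> 'h) \<Rightarrow> complex set" where
  "resolvent_set D A =
     {\<mu>. bij_betw (\<lambda>x. A x - \<mu> *\<^sub>C x) D UNIV \<and> bounded_linear (resolvent D A \<mu>)}"

definition compact_operator :: "('h::complex_hilbert_space \<Rightarrow> 'h) \<Rightarrow> bool" where
  "compact_operator T \<longleftrightarrow> bounded_linear T \<and> compact (closure (T ` cball 0 1))"

definition bounded_on :: "'h::complex_hilbert_space set \<Rightarrow> ('h \<Rightarrow> 'h) \<Rightarrow> bool" where
  "bounded_on D T \<longleftrightarrow> (\<exists>C. \<forall>x\<in>D. norm (T x) \<le> C * norm x)"

text \<open>The extension by continuity to all of \<open>H\<close>; it exists and is unique when \<open>T\<close> is linear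
  and bounded on a dense subspace \<open>D\<close>.\<close>

definition continuous_extension ::
    "'h::complex_hilbert_space set \<Rightarrow> ('h \<Rightarrow> 'h) \<Rightarrow> 'h \<Rightarrow> 'h" where
  "continuous_extension D T = (THE S. continuous_on UNIV S \<and> (\<forall>x\<in>D. S x = T x))"

definition sector :: "real \<Rightarrow> real \<Rightarrow> complex set" where
  "sector \<theta> \<delta> = {rcis r \<omega> | r \<omega>. r > 0 \<and> \<bar>\<omega> - \<theta>\<bar> < \<delta>}"

text \<open>The integral over the contour that comes in from infinity along the ray of angle \<open>\<beta>\<close>
  down to radius \<open>r0\<close>, follows the circle of radius \<open>r0\<close> clockwise from angle \<open>\<beta>\<close> to angle
  \<open>\<alpha> \<le> \<beta>\<close>, and goes out to infinity along the ray of angle \<open>\<alpha>\<close>.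
  The integrand is a function \<open>F r \<omega>\<close> of the polar coordinates of \<open>\<mu> = r e\<^sup>i\<^sup>\<omega>\<close>, so that it may take
  different values on two edges lying over the same ray.  On the rays
  \<open>d\<mu> = e\<^sup>i\<^sup>\<omega> dr\<close>, on the circle \<open>d\<mu> = i r0 e\<^sup>i\<^sup>\<omega> d\<omega>\<close>.\<close>

definition polar_contour_integral ::
    "real \<Rightarrow> real \<Rightarrow> real \<Rightarrow> (real \<Rightarrow> real \<Rightarrow> 'h::complex_hilbert_space) \<Rightarrow> 'h" where
  "polar_contour_integral r0 \<beta> \<alpha> F =
     - integral {r0..} (\<lambda>r. cis \<beta> *\<^sub>C F r \<beta>)
     - integral {\<alpha>..\<beta>} (\<lambda>\<omega>. (\<i> * rcis r0 \<omega>) *\<^sub>C F r0 \<omega>)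
     + integral {r0..} (\<lambda>r. cis \<alpha> *\<^sub>C F r \<alpha>)"

definition polar_contour_integrable ::
    "real \<Rightarrow> real \<Rightarrow> real \<Rightarrow> (real \<Rightarrow> real \<Rightarrow> 'h::complex_hilbert_space) \<Rightarrow> bool" where
  "polar_contour_integrable r0 \<beta> \<alpha> F \<longleftrightarrow>
     (\<lambda>r. cis \<beta> *\<^sub>C F r \<beta>) integrable_on {r0..} \<and>
     (\<lambda>\<omega>. (\<i> * rcis r0 \<omega>) *\<^sub>C F r0 \<omega>) integrable_on {\<alpha>..\<beta>} \<and>
     (\<lambda>r. cis \<alpha> *\<^sub>C F r \<alpha>) integrable_on {r0..}"

definition projection_integrand ::
    "'h::complex_hilbert_space set \<Rightarrow> ('h \<Rightarrow> 'h) \<Rightarrow> 'h \<Rightarrow> real \<Rightarrow> real \<Rightarrow> 'h" where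
  "projection_integrand D A x r \<omega> =
     inverse (rcis r \<omega>) *\<^sub>C A (resolvent D A (rcis r \<omega>) x)"

definition sectorial_projection ::
    "'h::complex_hilbert_space set \<Rightarrow> ('h \<Rightarrow> 'h) \<Rightarrow> real \<Rightarrow> real \<Rightarrow> real \<Rightarrow> 'h \<Rightarrow> 'h" where
  "sectorial_projection D A r0 \<theta> \<phi> x =
     (\<i> / (2 * pi)) *\<^sub>C polar_contour_integral r0 \<phi> \<theta> (projection_integrand D A x)"

text \<open>The logarithm of \<open>r e\<^sup>i\<^sup>\<omega>\<close> on the branch determined by the representative \<open>\<omega>\<close> of its argument.\<close>

definition polar_log :: "real \<Rightarrow> real \<Rightarrow> complex" where
  "polar_log r \<omega> = of_real (ln r) + \<i> * of_real \<omega>"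

definition log_integrand ::
    "'h::complex_hilbert_space set \<Rightarrow> ('h \<Rightarrow> 'h) \<Rightarrow> real \<Rightarrow> 'h \<Rightarrow> real \<Rightarrow> real \<Rightarrow> 'h" where
  "log_integrand D A s x r \<omega> =
     (exp (- of_real s * polar_log r \<omega>) * polar_log r \<omega>) *\<^sub>C resolvent D A (rcis r \<omega>) x"

definition log_approx ::
    "'h::complex_hilbert_space set \<Rightarrow> ('h \<Rightarrow> 'h) \<Rightarrow> real \<Rightarrow> real \<Rightarrow> real \<Rightarrow> 'h \<Rightarrow> 'h" where
  "log_approx D A r0 \<theta> s x =
     (\<i> / (2 * pi)) *\<^sub>C polar_contour_integral r0 \<theta> (\<theta> - 2 * pi) (log_integrand D A s x)"

definition op_log ::
    "'h::complex_hilbert_space set \<Rightarrow> ('h \<Rightarrow> 'h) \<Rightarrow> real \<Rightarrow> real \<Rightarrow> 'h \<Rightarrow> 'h" where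
  "op_log D A r0 \<theta> x = Lim (at_right 0) (\<lambda>s. log_approx D A r0 \<theta> s x)"

definition op_log_defined ::
    "'h::complex_hilbert_space set \<Rightarrow> ('h \<Rightarrow> 'h) \<Rightarrow> real \<Rightarrow> real \<Rightarrow> 'h \<Rightarrow> bool" where
  "op_log_defined D A r0 \<theta> x \<longleftrightarrow>
     (\<forall>s>0. polar_contour_integrable r0 \<theta> (\<theta> - 2 * pi) (log_integrand D A s x)) \<and>
     (\<exists>l. ((\<lambda>s. log_approx D A r0 \<theta> s x) \<longlongrightarrow> l) (at_right 0))"

end

theory Submission
  imports Defs
begin

text \<open>
  Write \<open>R(\<lambda>)\<close> for the resolvent.  The definition of \<open>log\<^sub>\<theta> A x\<close> integrates \<open>\<lambda>\<^sup>-\<^sup>s log \<lambda> R(\<lambda>) x\<close>, which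
  decays only like \<open>\<lambda>\<^sup>-\<^sup>1\<^sup>-\<^sup>s log \<lambda>\<close>.  For \<open>x\<close> in the domain,
  \<open>R(\<lambda>) x = \<lambda>\<^sup>-\<^sup>1 R(\<lambda>) A x - \<lambda>\<^sup>-\<^sup>1 x\<close> (\<open>resolvent_on_domain\<close>).  The scalar integrand \<open>\<lambda>\<^sup>-\<^sup>1\<^sup>-\<^sup>s log \<lambda>\<close> of the
  second term has an antiderivative that vanishes at both ends of the contour, so its integral is
  zero for every \<open>s > 0\<close> (\<open>polar_contour_integral_log_power\<close>).  The first term is of order
  \<open>\<lambda>\<^sup>-\<^sup>2 log \<lambda>\<close>, so \<open>s\<close> may tend to 0 under the integral (\<open>polar_contour_log_limit\<close>).  Hence, up to the
  factor \<open>\<i> / (2 * pi)\<close>, \<open>log\<^sub>\<theta> A x\<close> is the integral of \<open>log \<lambda> G(\<lambda>)\<close> with the single-valued function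
  \<open>G(\<lambda>) = \<lambda>\<^sup>-\<^sup>1 R(\<lambda>) A x = \<lambda>\<^sup>-\<^sup>1 A R(\<lambda>) x\<close> (\<open>op_log_on_domain\<close>).

  The branches are then compared without deforming contours.  On the two edges of the cut
  the values of the logarithm differ by \<open>2 * pi * \<i>\<close>, so the rays contribute a multiple of the integral
  of \<open>G\<close> along the ray of angle \<open>\<theta>\<close>, and of angle \<open>\<phi>\<close> for the other logarithm.  The circles belonging to \<open>\<theta>\<close> and \<open>\<phi>\<close> share an arc of the Riemann
  surface of the logarithm, and what is left of them are two arcs over the same arc of the plane, one
  sheet apart, which contribute a multiple of the integral of \<open>G\<close> along it.  Together these pieces
  are the contour of the sectorial projection (\<open>polar_contour_log_branch_difference\<close>).

  All of this requires the circle of radius \<open>r0\<close> to lie in the resolvent set, whereas the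
  hypotheses only exclude eigenvalues there.  Since the resolvent is compact at one point, every
  spectral value is an eigenvalue (\<open>compact_resolvent_spectrum\<close>); this rests on the Fredholm
  alternative for compact operators on a Banach space (\<open>fredholm_alternative\<close>).
\<close>

section \<open>Compact perturbations of the identity\<close>

text \<open>In Hilbert space one would take a unit vector orthogonal to the subspace; in a normed space
  dividing \<open>v - y\<close> by its norm, with \<open>y\<close> nearly realising the distance from \<open>v\<close>, is enough.\<close>

lemma riesz_almost_orthogonal:
  fixes X Y :: "'a::real_normed_vector set"
  assumes X: "subspace X" and Y: "subspace Y" "closed Y" and "Y \<subset> X"
  obtains u where "u \<in> X" "norm u = 1" "\<And>y. y \<in> Y \<Longrightarrow> 1 / 2 \<le> norm (u - y)"
proof -
  obtain v where v: "v \<in> X" "v \<notin> Y" using \<open>Y \<subset> X\<close> by blast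
  have ne: "Y \<noteq> {}" using Y(1) subspace_0 by blast
  define d where "d = infdist v Y"
  have d: "d > 0" unfolding d_def using Y(2) ne v(2) by (rule infdist_pos_not_in_closed)
  have "\<exists>y\<in>Y. dist v y < 2 * d"
  proof (rule ccontr)
    assume "\<not> ?thesis"
    then have "2 * d \<le> infdist v Y"
      unfolding infdist_notempty[OF ne] using ne by (intro cINF_greatest) (auto simp: not_less)
    then show False using d by (simp add: d_def)
  qed
  then obtain y where y: "y \<in> Y" "dist v y < 2 * d" by blast
  define n where "n = norm (v - y)"
  have n: "n > 0" "n < 2 * d" using y v by (auto simp: n_def dist_norm)
  show ?thesis
  proof (rule that[of "(1 / n) *\<^sub>R (v - y)"])
    show "(1 / n) *\<^sub>R (v - y) \<in> X"
      using X v y \<open>Y \<subset> X\<close> by (auto intro!: subspace_scale subspace_diff)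
    show "norm ((1 / n) *\<^sub>R (v - y)) = 1" using n by (simp add: n_def)
    fix z assume z: "z \<in> Y"
    have "y + n *\<^sub>R z \<in> Y" using Y(1) y(1) z by (intro subspace_add subspace_scale)
    then have "d \<le> norm (v - (y + n *\<^sub>R z))"
      unfolding d_def by (metis infdist_le dist_norm)
    also have "v - (y + n *\<^sub>R z) = n *\<^sub>R ((1 / n) *\<^sub>R (v - y) - z)"
      using n by (simp add: algebra_simps)
    also have "norm \<dots> = n * norm ((1 / n) *\<^sub>R (v - y) - z)" using n by simp
    finally have "d \<le> n * norm ((1 / n) *\<^sub>R (v - y) - z)" .
    moreover have "n * norm ((1 / n) *\<^sub>R (v - y) - z) < 2 * d * (1 / 2)"
      if "norm ((1 / n) *\<^sub>R (v - y) - z) < 1 / 2"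
      using n that d by (intro mult_strict_mono) auto
    ultimately show "1 / 2 \<le> norm ((1 / n) *\<^sub>R (v - y) - z)" by fastforce
  qed
qed

lemma relatively_compact_image_subsequence:
  fixes K :: "'a::real_normed_vector \<Rightarrow> 'b::real_normed_vector"
  assumes "compact (closure (K ` cball 0 1))" and "\<And>n. norm (u n) \<le> 1"
  obtains l r where "strict_mono (r :: nat \<Rightarrow> nat)" "(\<lambda>n. K (u (r n))) \<longlonglongrightarrow> l"
proof -
  have "\<forall>n. K (u n) \<in> closure (K ` cball 0 1)"
    using assms(2) closure_subset by (fastforce simp: dist_norm)
  then show ?thesis
    using seq_compactE[OF assms(1)[unfolded compact_eq_seq_compact_metric], of "\<lambda>n. K (u n)"] that
    by (auto simp: o_def)
qed

text \<open>If unit vectors \<open>u n\<close> satisfied \<open>u n - K (u n) \<longlonglongrightarrow> 0\<close>, compactness would give a subsequence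
  along which \<open>K (u n)\<close>, and hence \<open>u n\<close>, converges to a unit vector in the kernel.\<close>

lemma id_minus_compact_bounded_below:
  fixes K :: "'a::real_normed_vector \<Rightarrow> 'a"
  assumes K: "bounded_linear K" "compact (closure (K ` cball 0 1))"
    and ker: "\<And>x. x - K x = 0 \<Longrightarrow> x = 0"
  obtains e where "e > 0" "\<And>x. e * norm x \<le> norm (x - K x)"
proof -
  interpret K: bounded_linear K by fact
  have "\<exists>e>0. \<forall>x. e * norm x \<le> norm (x - K x)"
  proof (rule ccontr)
    assume neg: "\<not> ?thesis"
    have "\<exists>u. norm u = 1 \<and> norm (u - K u) < 1 / Suc n" for n
    proof -
      obtain x where x: "norm (x - K x) < 1 / Suc n * norm x"
        using spec[OF neg[unfolded not_ex], of "1 / Suc n"] by (auto simp: not_le)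
      then have x0: "norm x > 0" by (cases "x = 0") (auto simp: K.zero)
      have "norm ((1 / norm x) *\<^sub>R x - K ((1 / norm x) *\<^sub>R x)) = norm ((1 / norm x) *\<^sub>R (x - K x))"
        by (simp add: K.scaleR scaleR_diff_right)
      also have "\<dots> = norm (x - K x) / norm x" by (simp add: divide_inverse_commute)
      also have "\<dots> < 1 / Suc n" using x x0 by (simp only: pos_divide_less_eq)
      finally show ?thesis using x0 by (intro exI[of _ "(1 / norm x) *\<^sub>R x"]) simp
    qed
    then obtain u where u: "\<And>n. norm (u n) = 1" "\<And>n. norm (u n - K (u n)) < 1 / Suc n" by metis
    obtain l r where r: "strict_mono r" "(\<lambda>n. K (u (r n))) \<longlonglongrightarrow> l"
      by (rule relatively_compact_image_subsequence[OF K(2), of u]) (simp_all add: u(1))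
    have "(\<lambda>n. u n - K (u n)) \<longlonglongrightarrow> 0"
      by (rule Lim_null_comparison[OF _ LIMSEQ_inverse_real_of_nat])
        (use u(2) in \<open>auto intro!: always_eventually less_imp_le simp: inverse_eq_divide\<close>)
    then have "(\<lambda>n. u (r n) - K (u (r n))) \<longlonglongrightarrow> 0"
      using LIMSEQ_subseq_LIMSEQ[OF _ r(1), of "\<lambda>n. u n - K (u n)" 0] by (simp add: o_def)
    from tendsto_add[OF this r(2)] have ul: "(\<lambda>n. u (r n)) \<longlonglongrightarrow> l" by simp
    then have "(\<lambda>n. K (u (r n))) \<longlonglongrightarrow> K l" by (rule K.tendsto)
    then have "K l = l" using r(2) by (rule LIMSEQ_unique)
    then have "l = 0" using ker by simp
    moreover have "norm l = 1"
      using tendsto_norm[OF ul] u(1) by (simp add: LIMSEQ_const_iff)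
    ultimately show False by simp
  qed
  then show ?thesis using that by blast
qed

text \<open>If \<open>T = I - K\<close> were injective but not surjective, the ranges of its powers would be a strictly
  decreasing sequence of closed subspaces.  Picking an almost orthogonal unit vector in each of them
  gives a sequence whose images under \<open>K\<close> keep distance \<open>1 / 2\<close> from each other.\<close>

theorem fredholm_alternative:
  fixes K :: "'a::banach \<Rightarrow> 'a"
  assumes K: "bounded_linear K" "compact (closure (K ` cball 0 1))"
    and ker: "\<And>x. x - K x = 0 \<Longrightarrow> x = 0"
  shows "bij (\<lambda>x. x - K x)"
proof -
  interpret K: bounded_linear K by fact
  define T where "T x = x - K x" for x
  have T: "bounded_linear T" unfolding T_def by (intro bounded_linear_sub bounded_linear_ident K(1))
  interpret T: bounded_linear T by fact
  obtain e where e: "e > 0" "\<And>x. e * norm x \<le> norm (T x)"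
    unfolding T_def using id_minus_compact_bounded_below[OF K ker] by blast
  have inj: "inj T"
    using ker by (subst linear_injective_0[OF T.linear]) (auto simp: T_def)
  have "surj T"
  proof (rule ccontr)
    assume "\<not> surj T"
    then obtain z where z: "z \<notin> range T" by blast
    define M where "M n = (T ^^ n) ` UNIV" for n
    have M_Suc: "M (Suc n) = T ` M n" for n by (simp add: M_def image_comp)
    have M: "subspace (M n) \<and> complete (M n)" for n
    proof (induction n)
      case 0 show ?case by (simp add: M_def complete_UNIV)
    next
      case (Suc n)
      then show ?case unfolding M_Suc
        using complete_isometric_image[OF e(1) _ T, of "M n"] e(2) by (simp add: T.linear linear_subspace_image)
    qed
    have sub: "M (Suc n) \<subset> M n" for n
    proof -
      have *: "M (Suc n) = (T ^^ n) ` range T" by (simp add: M_def image_comp funpow_Suc_right del: funpow.simps)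
      have "(T ^^ n) z \<notin> M (Suc n)"
        unfolding * using z by (simp add: inj_image_mem_iff[OF inj_fn[OF inj]])
      then show ?thesis unfolding * unfolding M_def by blast
    qed
    have dec: "M m \<subseteq> M n" if "n \<le> m" for n m
      by (rule lift_Suc_antimono_le[of M, OF _ that]) (simp add: psubset_imp_subset[OF sub])
    have "\<exists>u\<in>M n. norm u = 1 \<and> (\<forall>y\<in>M (Suc n). 1 / 2 \<le> norm (u - y))" for n
    proof -
      have "closed (M (Suc n))" using M[of "Suc n"] complete_imp_closed by blast
      then obtain u where "u \<in> M n" "norm u = 1" "\<And>y. y \<in> M (Suc n) \<Longrightarrow> 1 / 2 \<le> norm (u - y)"
        using riesz_almost_orthogonal[of "M n" "M (Suc n)"] M[of n] M[of "Suc n"] sub[of n] by blast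
      then show ?thesis by blast
    qed
    then obtain u where u: "\<And>n. u n \<in> M n" "\<And>n. norm (u n) = 1"
        "\<And>n y. y \<in> M (Suc n) \<Longrightarrow> 1 / 2 \<le> norm (u n - y)" by metis
    have sep: "1 / 2 \<le> norm (K (u n) - K (u m))" if "n < m" for n m
    proof -
      have "u m \<in> M (Suc n)" "T (u m) \<in> M (Suc n)" "T (u n) \<in> M (Suc n)"
        using u(1) dec[of "Suc n" m] dec[of n m] that by (auto simp: M_Suc)
      then have "T (u n) + u m - T (u m) \<in> M (Suc n)"
        using M by (intro subspace_add subspace_diff) auto
      from u(3)[OF this] show ?thesis by (simp add: T_def algebra_simps)
    qed
    obtain l r where r: "strict_mono r" "(\<lambda>n. K (u (r n))) \<longlonglongrightarrow> l"
      by (rule relatively_compact_image_subsequence[OF K(2), of u]) (simp_all add: u(2))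
    from LIMSEQ_imp_Cauchy[OF r(2)] obtain N where
      "\<And>n m. n \<ge> N \<Longrightarrow> m \<ge> N \<Longrightarrow> dist (K (u (r n))) (K (u (r m))) < 1 / 2"
      using metric_CauchyD[of "\<lambda>n. K (u (r n))" "1 / 2"] by (auto simp: o_def)
    from this[of N "Suc N"] show False
      using sep[of "r N" "r (Suc N)"] r(1) by (simp add: dist_norm strict_mono_Suc_iff)
  qed
  with inj show ?thesis by (simp add: bij_def T_def[abs_def])
qed

section \<open>Complex scalar multiplication and improper integrals\<close>

lemma norm_scaleC: "norm (a *\<^sub>C x) = cmod a * norm (x :: 'h::complex_hilbert_space)"
proof -
  have "complex_of_real ((norm (a *\<^sub>C x))\<^sup>2) = a * cinner x (a *\<^sub>C x)"
    by (metis cinner_self cinner_scaleC_left)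
  also have "cinner x (a *\<^sub>C x) = cnj a * cinner x x"
    by (metis cinner_commute cinner_scaleC_left complex_cnj_mult)
  also have "a * (cnj a * cinner x x) = complex_of_real ((cmod a)\<^sup>2 * (norm x)\<^sup>2)"
    by (simp add: cinner_self complex_norm_square[symmetric] flip: mult.assoc of_real_power)
  finally have "(norm (a *\<^sub>C x))\<^sup>2 = (cmod a * norm x)\<^sup>2"
    unfolding of_real_eq_iff by (simp add: power_mult_distrib)
  then show ?thesis by (simp add: power2_eq_iff_nonneg)
qed

interpretation scaleC: bounded_bilinear "scaleC :: complex \<Rightarrow> 'h::complex_hilbert_space \<Rightarrow> 'h"
proof
  fix a b :: complex and x y :: 'h and r :: real
  show "(a + b) *\<^sub>C x = a *\<^sub>C x + b *\<^sub>C x" by (rule scaleC_add_left)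
  show "a *\<^sub>C (x + y) = a *\<^sub>C x + a *\<^sub>C y" by (rule scaleC_add_right)
  show "(r *\<^sub>R a) *\<^sub>C x = r *\<^sub>R a *\<^sub>C x"
    by (simp add: scaleR_conv_of_real scaleC_scaleC flip: scaleC_of_real)
  show "a *\<^sub>C r *\<^sub>R x = r *\<^sub>R a *\<^sub>C x"
    by (simp add: scaleC_scaleC mult.commute flip: scaleC_of_real)
  show "\<exists>K. \<forall>a x. norm (a *\<^sub>C x :: 'h) \<le> norm a * norm x * K"
    by (intro exI[of _ 1]) (simp add: norm_scaleC)
qed

lemma scaleC_one [simp]: "1 *\<^sub>C x = (x :: 'h::complex_hilbert_space)"
  using scaleC_of_real[of 1 x] by simp

lemma integral_scaleC:
  fixes f :: "real \<Rightarrow> 'h::complex_hilbert_space"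
  assumes "f integrable_on S"
  shows "(\<lambda>t. c *\<^sub>C f t) integrable_on S" "integral S (\<lambda>t. c *\<^sub>C f t) = c *\<^sub>C integral S f"
  using integrable_linear[OF assms scaleC.bounded_linear_right]
    integral_linear[OF assms scaleC.bounded_linear_right] by (simp_all add: o_def)

text \<open>A comparison test for values in an arbitrary, possibly nonseparable, Banach space.  It follows
  from the Cauchy criterion over growing intervals: enlarging an interval changes the integral of
  \<open>f\<close> by at most as much as that of \<open>g\<close>.\<close>

lemma integrable_on_dominated:
  fixes f :: "real \<Rightarrow> 'a::banach" and g :: "real \<Rightarrow> real"
  assumes loc: "\<And>a b. (\<lambda>x. if x \<in> S then f x else 0) integrable_on {a..b}"
    and g: "g integrable_on S" and le: "\<And>x. x \<in> S \<Longrightarrow> norm (f x) \<le> g x"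
  shows "f integrable_on S"
proof -
  define F where "F = (\<lambda>x. if x \<in> S then f x else 0)"
  define G where "G = (\<lambda>x. if x \<in> S then g x else 0)"
  have intF: "F integrable_on {a..b}" for a b using loc by (simp add: F_def)
  have intG: "G integrable_on {a..b}" for a b
    using g unfolding G_def by (auto simp: integrable_alt[of g])
  have FG: "norm (integral {a..b} F) \<le> integral {a..b} G" for a b
    using intF intG le by (intro integral_norm_bound_integral) (auto simp: F_def G_def)
  have nest: "norm (integral {a..b} F - integral {c..d} F) \<le> \<bar>integral {a..b} G - integral {c..d} G\<bar>"
    if "a \<le> b" "{a..b} \<subseteq> {c..d}" for a b c d
  proof -
    have cd: "c \<le> a" "b \<le> d" using that by auto
    have "norm (integral {a..b} F - integral {c..d} F) = norm (integral {c..a} F + integral {b..d} F)"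
    proof -
      have "integral {c..d} F = integral {c..a} F + integral {a..b} F + integral {b..d} F"
        using cd that(1) intF Henstock_Kurzweil_Integration.integral_combine[where a=c and c=a and b=b and f=F] Henstock_Kurzweil_Integration.integral_combine[where a=c and c=b and b=d and f=F]
        by simp
      then have "integral {a..b} F - integral {c..d} F = - (integral {c..a} F + integral {b..d} F)"
        by simp
      then show ?thesis by (simp only: norm_minus_cancel)
    qed
    also have "\<dots> \<le> integral {c..a} G + integral {b..d} G"
      by (intro norm_triangle_le add_mono FG)
    also have "\<dots> \<le> \<bar>integral {a..b} G - integral {c..d} G\<bar>"
      using cd that(1) intG Henstock_Kurzweil_Integration.integral_combine[where a=c and c=a and b=b and f=G] Henstock_Kurzweil_Integration.integral_combine[where a=c and c=b and b=d and f=G] by simp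
    finally show ?thesis .
  qed
  show ?thesis unfolding integrable_alt_subset[of f]
  proof (intro conjI allI impI)
    show "(\<lambda>x. if x \<in> S then f x else 0) integrable_on cbox a b" for a b using loc by simp
    fix e :: real assume "e > 0"
    then obtain B where B: "B > 0" "\<And>a b c d. ball 0 B \<subseteq> cbox a b \<Longrightarrow> cbox a b \<subseteq> cbox c d \<Longrightarrow>
        norm (integral (cbox a b) G - integral (cbox c d) G) < e"
      using g unfolding integrable_alt_subset[of g] G_def by meson
    have "norm (integral (cbox a b) F - integral (cbox c d) F) < e"
      if "ball 0 B \<subseteq> cbox a b" "cbox a b \<subseteq> cbox c d" for a b c d
    proof -
      have "0 \<in> cbox a b" using that(1) B(1) centre_in_ball[of 0 B] by blast
      then have "a \<le> b" by auto
      with nest[of a b c d] B(2)[OF that] that(2) show ?thesis by simp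
    qed
    with B(1) show "\<exists>B>0. \<forall>a b c d. ball 0 B \<subseteq> cbox a b \<and> cbox a b \<subseteq> cbox c d \<longrightarrow>
        norm (integral (cbox a b) (\<lambda>x. if x \<in> S then f x else 0)
          - integral (cbox c d) (\<lambda>x. if x \<in> S then f x else 0)) < e"
      unfolding F_def by blast
  qed
qed

lemma integrable_on_restrict_Ici:
  fixes f :: "real \<Rightarrow> 'a::banach"
  assumes "\<And>b. f integrable_on {a..b}"
  shows "(\<lambda>x. if x \<in> {a..} then f x else 0) integrable_on {c..d}"
proof -
  have "{a..} \<inter> {c..d} = {max a c..d}" by auto
  moreover have "f integrable_on {max a c..d}"
    by (rule integrable_on_subinterval[OF assms[of d]]) auto
  ultimately show ?thesis by (simp add: integrable_restrict_Int del: atLeast_iff)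
qed

lemma continuous_dominated_integrable_Ici:
  fixes f :: "real \<Rightarrow> 'a::banach"
  assumes "continuous_on {a..} f" "g integrable_on {a..}" "\<And>x. x \<ge> a \<Longrightarrow> norm (f x) \<le> g x"
  shows "f integrable_on {a..}"
proof (rule integrable_on_dominated[OF integrable_on_restrict_Ici assms(2)])
  show "f integrable_on {a..b}" for b
    by (intro integrable_continuous_real continuous_on_subset[OF assms(1)]) auto
qed (use assms(3) in auto)

lemma fundamental_theorem_of_calculus_Ici:
  fixes f :: "real \<Rightarrow> 'a::banach"
  assumes deriv: "\<And>x. x \<ge> a \<Longrightarrow> (f has_vector_derivative f' x) (at x)"
    and lim: "(f \<longlongrightarrow> l) at_top"
  shows "(f' has_integral (l - f a)) {a..}"
proof -
  have ftc: "(f' has_integral (f b - f a)) {a..b}" if "a \<le> b" for b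
    using that deriv by (intro fundamental_theorem_of_calculus) (auto intro: has_vector_derivative_at_within)
  have int: "f' integrable_on {a..b}" for b
    using ftc[of b] by (cases "a \<le> b") (auto simp: integrable_on_def)
  show ?thesis unfolding has_integral_alt'
  proof (intro conjI allI impI)
    show "(\<lambda>x. if x \<in> {a..} then f' x else 0) integrable_on cbox c d" for c d :: real
      using integrable_on_restrict_Ici[OF int] by simp
    fix e :: real assume "e > 0"
    then obtain N where N: "\<And>b. b \<ge> N \<Longrightarrow> norm (f b - l) < e"
      using lim unfolding tendsto_iff eventually_at_top_linorder dist_norm by blast
    show "\<exists>B>0. \<forall>c d. ball 0 B \<subseteq> cbox c d \<longrightarrow>
        norm (integral (cbox c d) (\<lambda>x. if x \<in> {a..} then f' x else 0) - (l - f a)) < e"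
    proof (intro exI[of _ "\<bar>a\<bar> + \<bar>N\<bar> + 1"] conjI allI impI)
      fix c d :: real assume "ball 0 (\<bar>a\<bar> + \<bar>N\<bar> + 1) \<subseteq> cbox c d"
      moreover have "a \<in> ball 0 (\<bar>a\<bar> + \<bar>N\<bar> + 1)" "N \<in> ball 0 (\<bar>a\<bar> + \<bar>N\<bar> + 1)"
        by auto
      ultimately have "a \<in> cbox c d" "N \<in> cbox c d" by blast+
      then have cd: "c \<le> a" "a \<le> d" "N \<le> d" by auto
      then have "{a..} \<inter> {c..d} = {a..d}" by auto
      then have "integral (cbox c d) (\<lambda>x. if x \<in> {a..} then f' x else 0) = f d - f a"
        using integral_unique[OF ftc[OF cd(2)]]
        by (simp only: integral_restrict_Int cbox_interval)
      then show "norm (integral (cbox c d) (\<lambda>x. if x \<in> {a..} then f' x else 0) - (l - f a)) < e"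
        using N[OF cd(3)] by simp
    qed auto
  qed
qed

section \<open>The resolvent\<close>

lemma resolvent_in_domain:
  assumes "\<mu> \<in> resolvent_set D A"
  shows "resolvent D A \<mu> y \<in> D"
  using assms unfolding resolvent_set_def resolvent_def bij_betw_def
  by (auto intro!: inv_into_into)

lemma operator_resolvent:
  assumes "\<mu> \<in> resolvent_set D A"
  shows "A (resolvent D A \<mu> y) = y + \<mu> *\<^sub>C resolvent D A \<mu> y"
proof -
  have "y \<in> (\<lambda>x. A x - \<mu> *\<^sub>C x) ` D"
    using assms by (simp add: resolvent_set_def bij_betw_def)
  from f_inv_into_f[OF this] show ?thesis
    unfolding resolvent_def by (simp add: diff_eq_eq)
qed

lemma resolvent_operator_minus:
  assumes "\<mu> \<in> resolvent_set D A" and "x \<in> D"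
  shows "resolvent D A \<mu> (A x - \<mu> *\<^sub>C x) = x"
  using assms inv_into_f_f[of "\<lambda>x. A x - \<mu> *\<^sub>C x" D x]
  unfolding resolvent_set_def resolvent_def bij_betw_def by blast

lemma bounded_linear_resolvent:
  "\<mu> \<in> resolvent_set D A \<Longrightarrow> bounded_linear (resolvent D A \<mu>)"
  by (simp add: resolvent_set_def)

lemma resolvent_scaleC:
  assumes "clinear_operator D A" "\<mu> \<in> resolvent_set D A"
  shows "resolvent D A \<mu> (c *\<^sub>C y) = c *\<^sub>C resolvent D A \<mu> y"
proof -
  let ?x = "resolvent D A \<mu> y"
  have x: "?x \<in> D" using assms(2) by (rule resolvent_in_domain)
  have "A (c *\<^sub>C ?x) - \<mu> *\<^sub>C c *\<^sub>C ?x = c *\<^sub>C (A ?x - \<mu> *\<^sub>C ?x)"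
    using assms(1) x by (simp add: clinear_operator_def scaleC.diff_right scaleC_scaleC mult.commute)
  also have "\<dots> = c *\<^sub>C y" using operator_resolvent[OF assms(2)] by simp
  finally show ?thesis
    using resolvent_operator_minus[OF assms(2), of "c *\<^sub>C ?x"] assms(1) x
    by (simp add: clinear_operator_def)
qed

lemma operator_resolvent_commute:
  assumes "clinear_operator D A" "\<mu> \<in> resolvent_set D A" "x \<in> D"
  shows "A (resolvent D A \<mu> x) = resolvent D A \<mu> (A x)"
proof -
  interpret R: bounded_linear "resolvent D A \<mu>" by (rule bounded_linear_resolvent) fact
  have "resolvent D A \<mu> (A x) = resolvent D A \<mu> ((A x - \<mu> *\<^sub>C x) + \<mu> *\<^sub>C x)" by simp
  also have "\<dots> = x + \<mu> *\<^sub>C resolvent D A \<mu> x"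
    by (simp only: R.add resolvent_operator_minus[OF assms(2,3)] resolvent_scaleC[OF assms(1,2)])
  finally show ?thesis using operator_resolvent[OF assms(2)] by simp
qed

text \<open>On the domain the resolvent splits into a multiple of the identity and a term that decays one
  order faster.\<close>

lemma resolvent_on_domain:
  assumes "clinear_operator D A" "\<mu> \<in> resolvent_set D A" "x \<in> D" "\<mu> \<noteq> 0"
  shows "resolvent D A \<mu> x = inverse \<mu> *\<^sub>C resolvent D A \<mu> (A x) - inverse \<mu> *\<^sub>C x"
  using assms(4) operator_resolvent[OF assms(2), of x]
  by (simp add: operator_resolvent_commute[OF assms(1-3), symmetric] scaleC_add_right scaleC_scaleC)

lemma resolvent_identity:
  assumes "clinear_operator D A" "\<nu> \<in> resolvent_set D A" "\<mu> \<in> resolvent_set D A"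
  shows "resolvent D A \<nu> y = resolvent D A \<mu> y + (\<nu> - \<mu>) *\<^sub>C resolvent D A \<mu> (resolvent D A \<nu> y)"
proof -
  interpret R: bounded_linear "resolvent D A \<mu>" by (rule bounded_linear_resolvent) fact
  let ?x = "resolvent D A \<nu> y"
  have "A ?x - \<mu> *\<^sub>C ?x = y + (\<nu> - \<mu>) *\<^sub>C ?x"
    using operator_resolvent[OF assms(2)] by (simp add: scaleC.diff_left)
  then have "?x = resolvent D A \<mu> (y + (\<nu> - \<mu>) *\<^sub>C ?x)"
    using resolvent_operator_minus[OF assms(3) resolvent_in_domain[OF assms(2)]] by metis
  then show ?thesis
    by (simp add: R.add resolvent_scaleC[OF assms(1,3)])
qed

text \<open>By the resolvent identity, \<open>norm (R \<nu> y) \<le> 2 * norm (R \<mu> y)\<close> as soon as \<open>\<nu>\<close> is within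
  \<open>1 / (2 * onorm (R \<mu>))\<close> of \<open>\<mu>\<close>; a second use of the identity gives continuity at \<open>\<mu>\<close>.\<close>

lemma continuous_on_resolvent:
  assumes lin: "clinear_operator D A"
  shows "continuous_on (resolvent_set D A) (\<lambda>\<mu>. resolvent D A \<mu> y)"
  unfolding continuous_on_def
proof
  fix \<mu> assume mu: "\<mu> \<in> resolvent_set D A"
  interpret R: bounded_linear "resolvent D A \<mu>" using mu by (rule bounded_linear_resolvent)
  obtain B where B: "B > 0" "\<And>z. norm (resolvent D A \<mu> z) \<le> norm z * B"
    using R.pos_bounded by blast
  define M where "M = 2 * norm (resolvent D A \<mu> y)"
  have bd: "norm (resolvent D A \<nu> y - resolvent D A \<mu> y) \<le> cmod (\<nu> - \<mu>) * (M * B)"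
    if "\<nu> \<in> resolvent_set D A" "dist \<nu> \<mu> < 1 / (2 * B)" for \<nu>
  proof -
    let ?x = "resolvent D A \<nu> y"
    have small: "cmod (\<nu> - \<mu>) * B \<le> 1 / 2"
      using that(2) B(1) by (simp add: dist_norm field_simps)
    have diff: "norm (?x - resolvent D A \<mu> y) \<le> cmod (\<nu> - \<mu>) * (norm ?x * B)"
    proof -
      have "?x - resolvent D A \<mu> y = (\<nu> - \<mu>) *\<^sub>C resolvent D A \<mu> ?x"
        using resolvent_identity[OF lin that(1) mu, of y] by (simp add: diff_eq_eq add.commute)
      then show ?thesis using B(2)[of ?x] by (simp add: norm_scaleC mult_left_mono)
    qed
    also have "\<dots> \<le> 1 / 2 * norm ?x"
      using mult_right_mono[OF small norm_ge_zero[of ?x]] by (simp add: mult_ac)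
    finally have "norm ?x \<le> M"
      using norm_triangle_ineq2[of ?x "resolvent D A \<mu> y"] by (simp add: M_def)
    then have "cmod (\<nu> - \<mu>) * (norm ?x * B) \<le> cmod (\<nu> - \<mu>) * (M * B)"
      using B(1) by (intro mult_left_mono mult_right_mono) auto
    with diff show ?thesis by linarith
  qed
  have "((\<lambda>\<nu>. cmod (\<nu> - \<mu>) * (M * B)) \<longlongrightarrow> cmod (\<mu> - \<mu>) * (M * B)) (at \<mu> within resolvent_set D A)"
    by (intro tendsto_intros)
  then have lim: "((\<lambda>\<nu>. cmod (\<nu> - \<mu>) * (M * B)) \<longlongrightarrow> 0) (at \<mu> within resolvent_set D A)" by simp
  have "\<forall>\<^sub>F \<nu> in at \<mu> within resolvent_set D A.
      norm (resolvent D A \<nu> y - resolvent D A \<mu> y) \<le> cmod (\<nu> - \<mu>) * (M * B)"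
    unfolding eventually_at using bd B(1) by (intro exI[of _ "1 / (2 * B)"]) auto
  from Lim_null_comparison[OF this lim]
  show "((\<lambda>\<mu>. resolvent D A \<mu> y) \<longlongrightarrow> resolvent D A \<mu> y) (at \<mu> within resolvent_set D A)"
    by (rule LIM_zero_cancel)
qed

text \<open>Factoring \<open>A - \<nu> = (I - (\<nu> - \<mu>) R \<mu>) (A - \<mu>)\<close> reduces bijectivity of \<open>A - \<nu>\<close> to the Fredholm
  alternative, since a kernel vector \<open>w\<close> of the first factor makes \<open>R \<mu> w\<close> an eigenvector.\<close>

lemma compact_resolvent_spectrum:
  assumes lin: "clinear_operator D A" and mu: "\<mu> \<in> resolvent_set D A"
    and comp: "compact_operator (resolvent D A \<mu>)" and not_eig: "\<not> eigenvalue D A \<nu>"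
  shows "\<nu> \<in> resolvent_set D A"
proof -
  interpret R: bounded_linear "resolvent D A \<mu>" using mu by (rule bounded_linear_resolvent)
  define K where "K w = (\<nu> - \<mu>) *\<^sub>C resolvent D A \<mu> w" for w
  have K: "bounded_linear K"
    unfolding K_def by (rule bounded_linear_compose[OF scaleC.bounded_linear_right R.bounded_linear])
  have "compact (closure (K ` cball 0 1))"
  proof -
    let ?C = "(\<lambda>z. (\<nu> - \<mu>) *\<^sub>C z) ` closure (resolvent D A \<mu> ` cball 0 1)"
    have C: "compact ?C"
      using comp unfolding compact_operator_def
      by (intro compact_continuous_image linear_continuous_on scaleC.bounded_linear_right) auto
    have "K ` cball 0 1 \<subseteq> ?C"
      using closure_subset[of "resolvent D A \<mu> ` cball 0 1"] by (auto simp: K_def)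
    then have "closure (K ` cball 0 1) \<subseteq> ?C"
      using C by (intro closure_minimal compact_imp_closed)
    then show ?thesis using compact_Int_closed[OF C closed_closure] by (metis inf.absorb_iff2)
  qed
  moreover have ker: "w = 0" if "w - K w = 0" for w
  proof -
    let ?x = "resolvent D A \<mu> w"
    have w: "w = (\<nu> - \<mu>) *\<^sub>C ?x" using that by (simp add: K_def)
    have "A ?x = w + \<mu> *\<^sub>C ?x" by (rule operator_resolvent[OF mu])
    also have "\<dots> = \<nu> *\<^sub>C ?x" by (subst w) (simp add: scaleC.diff_left)
    finally have "?x = 0"
      using not_eig resolvent_in_domain[OF mu, of w] unfolding eigenvalue_def by blast
    with w show "w = 0" by (simp add: scaleC.zero_right)
  qed
  ultimately have bij: "bij (\<lambda>w. w - K w)" by (intro fredholm_alternative[OF K]) auto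
  have bijmu: "bij_betw (\<lambda>x. A x - \<mu> *\<^sub>C x) D UNIV"
    using mu by (simp add: resolvent_set_def)
  have "(\<lambda>w. w - K w) (A x - \<mu> *\<^sub>C x) = A x - \<nu> *\<^sub>C x" if "x \<in> D" for x
    using resolvent_operator_minus[OF mu that] by (simp add: K_def scaleC.diff_left)
  with bij_betw_trans[OF bijmu bij] have bijl: "bij_betw (\<lambda>x. A x - \<nu> *\<^sub>C x) D UNIV"
    by (subst bij_betw_cong[where g = "(\<lambda>w. w - K w) \<circ> (\<lambda>x. A x - \<mu> *\<^sub>C x)"]) (auto simp: o_def)
  define S where "S = inv (\<lambda>w. w - K w)"
  have S: "S y - K (S y) = y" for y
    unfolding S_def using surj_f_inv_f[OF bij_is_surj[OF bij]] by simp
  have S_unique: "S y = w" if "w - K w = y" for y w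
    using inv_f_f[OF bij_is_inj[OF bij], of w] that by (simp add: S_def)
  interpret K: bounded_linear K by (rule K)
  have "bounded_linear S"
  proof -
    obtain e where e: "e > 0" "\<And>x. e * norm x \<le> norm (x - K x)"
      using id_minus_compact_bounded_below[OF K \<open>compact (closure (K ` cball 0 1))\<close> ker] by blast
    show ?thesis
    proof (rule bounded_linear_intro[where K = "1 / e"])
      show "S (x + y) = S x + S y" for x y
        by (intro S_unique) (simp add: K.add add_diff_add S)
      show "S (r *\<^sub>R x) = r *\<^sub>R S x" for r x
        using S[of x] by (intro S_unique) (simp add: K.scaleR flip: scaleR_diff_right)
      show "norm (S x) \<le> norm x * (1 / e)" for x
        using e(2)[of "S x"] e(1) by (simp add: S field_simps)
    qed
  qed
  moreover have "resolvent D A \<nu> y = resolvent D A \<mu> (S y)" for y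
  proof -
    let ?x = "resolvent D A \<mu> (S y)"
    have x: "?x \<in> D" by (rule resolvent_in_domain[OF mu])
    have "A ?x - \<nu> *\<^sub>C ?x = S y - K (S y)"
      using operator_resolvent[OF mu, of "S y"] by (simp add: K_def scaleC.diff_left)
    then have "A ?x - \<nu> *\<^sub>C ?x = y" by (simp add: S)
    then show ?thesis
      unfolding resolvent_def[of D A \<nu>]
      using inv_into_f_f[OF bij_betw_imp_inj_on[OF bijl] x] by simp
  qed
  ultimately have "bounded_linear (resolvent D A \<nu>)"
    using bounded_linear_compose[OF R.bounded_linear, of S] by (subst ext[where f = "resolvent D A \<nu>"])
  with bijl show ?thesis by (simp add: resolvent_set_def)
qed

section \<open>Contours in polar coordinates\<close>

text \<open>The contour as a set of polar coordinates rather than of complex numbers, so that two edges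
  lying over the same ray remain distinct.\<close>

definition polar_contour :: "real \<Rightarrow> real \<Rightarrow> real \<Rightarrow> (real \<times> real) set" where
  "polar_contour r0 \<beta> \<alpha> = {r0..} \<times> {\<alpha>, \<beta>} \<union> {r0} \<times> {\<alpha>..\<beta>}"

lemma cis_minus_2pi: "cis (\<omega> - 2 * pi) = cis \<omega>"
  by (simp add: complex_eq_iff cos_diff sin_diff)

lemma rcis_minus_2pi: "rcis r (\<omega> - 2 * pi) = rcis r \<omega>"
  by (simp add: rcis_def cis_minus_2pi)

lemma polar_contour_cong:
  assumes "\<And>r \<omega>. (r, \<omega>) \<in> polar_contour r0 \<beta> \<alpha> \<Longrightarrow> F r \<omega> = G r \<omega>"
  shows "polar_contour_integrable r0 \<beta> \<alpha> F \<longleftrightarrow> polar_contour_integrable r0 \<beta> \<alpha> G"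
    and "polar_contour_integral r0 \<beta> \<alpha> F = polar_contour_integral r0 \<beta> \<alpha> G"
proof -
  have ray: "cis \<omega> *\<^sub>C F r \<omega> = cis \<omega> *\<^sub>C G r \<omega>" if "\<omega> \<in> {\<alpha>, \<beta>}" "r \<in> {r0..}" for r \<omega>
    using that assms by (auto simp: polar_contour_def)
  have arc: "(\<i> * rcis r0 \<omega>) *\<^sub>C F r0 \<omega> = (\<i> * rcis r0 \<omega>) *\<^sub>C G r0 \<omega>" if "\<omega> \<in> {\<alpha>..\<beta>}" for \<omega>
    using that assms by (simp add: polar_contour_def)
  have ray_eq: "integral {r0..} (\<lambda>r. cis \<omega> *\<^sub>C F r \<omega>) = integral {r0..} (\<lambda>r. cis \<omega> *\<^sub>C G r \<omega>)"
      "(\<lambda>r. cis \<omega> *\<^sub>C F r \<omega>) integrable_on {r0..} \<longleftrightarrow> (\<lambda>r. cis \<omega> *\<^sub>C G r \<omega>) integrable_on {r0..}"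
    if "\<omega> \<in> {\<alpha>, \<beta>}" for \<omega>
    using ray[OF that] by (intro integral_cong integrable_cong; blast)+
  have arc_eq: "integral {\<alpha>..\<beta>} (\<lambda>\<omega>. (\<i> * rcis r0 \<omega>) *\<^sub>C F r0 \<omega>) =
        integral {\<alpha>..\<beta>} (\<lambda>\<omega>. (\<i> * rcis r0 \<omega>) *\<^sub>C G r0 \<omega>)"
      "(\<lambda>\<omega>. (\<i> * rcis r0 \<omega>) *\<^sub>C F r0 \<omega>) integrable_on {\<alpha>..\<beta>} \<longleftrightarrow>
        (\<lambda>\<omega>. (\<i> * rcis r0 \<omega>) *\<^sub>C G r0 \<omega>) integrable_on {\<alpha>..\<beta>}"
    using arc by (intro integral_cong integrable_cong; blast)+
  show "polar_contour_integrable r0 \<beta> \<alpha> F \<longleftrightarrow> polar_contour_integrable r0 \<beta> \<alpha> G"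
    and "polar_contour_integral r0 \<beta> \<alpha> F = polar_contour_integral r0 \<beta> \<alpha> G"
    unfolding polar_contour_integrable_def polar_contour_integral_def
    using ray_eq arc_eq by simp_all
qed

lemma polar_contour_diff:
  assumes "polar_contour_integrable r0 \<beta> \<alpha> F" "polar_contour_integrable r0 \<beta> \<alpha> G"
  shows "polar_contour_integrable r0 \<beta> \<alpha> (\<lambda>r \<omega>. F r \<omega> - G r \<omega>)"
    and "polar_contour_integral r0 \<beta> \<alpha> (\<lambda>r \<omega>. F r \<omega> - G r \<omega>) =
      polar_contour_integral r0 \<beta> \<alpha> F - polar_contour_integral r0 \<beta> \<alpha> G"
  using assms unfolding polar_contour_integrable_def polar_contour_integral_def
  by (auto simp: scaleC.diff_right integral_diff intro: integrable_diff)

text \<open>Any exponent below \<open>-1\<close> would do; \<open>-3/2\<close> leaves half a power to absorb logarithms multiplying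
  a function of order \<open>r powr (-2)\<close>.\<close>

lemma polar_contour_dominated:
  fixes F :: "real \<Rightarrow> real \<Rightarrow> 'h::complex_hilbert_space"
  assumes r0: "r0 > 0" and "\<alpha> \<le> \<beta>"
    and cont: "continuous_on (polar_contour r0 \<beta> \<alpha>) (\<lambda>(r, \<omega>). F r \<omega>)"
    and bound: "\<And>r \<omega>. (r, \<omega>) \<in> polar_contour r0 \<beta> \<alpha> \<Longrightarrow> norm (F r \<omega>) \<le> M * r powr (-3/2)"
  shows "polar_contour_integrable r0 \<beta> \<alpha> F"
    and "norm (polar_contour_integral r0 \<beta> \<alpha> F) \<le> M * ((4 + (\<beta> - \<alpha>)) * r0 powr (-1/2))"
proof -
  have powr: "((\<lambda>r. M * r powr (-3/2)) has_integral M * (2 * r0 powr (-1/2))) {r0..}"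
    using has_integral_mult_right[OF has_integral_powr_to_inf[of "-3/2" r0], of M] r0 by (simp add: mult.commute)
  have ray: "(\<lambda>r. cis \<omega> *\<^sub>C F r \<omega>) integrable_on {r0..}"
      "norm (integral {r0..} (\<lambda>r. cis \<omega> *\<^sub>C F r \<omega>)) \<le> M * (2 * r0 powr (-1/2))"
    if "\<omega> \<in> {\<alpha>, \<beta>}" for \<omega>
  proof -
    have "continuous_on {r0..} (\<lambda>r. (\<lambda>(r, \<omega>). F r \<omega>) (r, \<omega>))"
      by (rule continuous_on_compose2[OF cont])
        (use that in \<open>auto simp: polar_contour_def intro!: continuous_intros\<close>)
    then have cF: "continuous_on {r0..} (\<lambda>r. cis \<omega> *\<^sub>C F r \<omega>)"
      by (intro scaleC.continuous_on continuous_intros) simp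
    have le: "norm (cis \<omega> *\<^sub>C F r \<omega>) \<le> M * r powr (-3/2)" if "r \<ge> r0" for r
      using bound[of r \<omega>] that \<open>\<omega> \<in> {\<alpha>, \<beta>}\<close> by (auto simp: norm_scaleC polar_contour_def)
    show i: "(\<lambda>r. cis \<omega> *\<^sub>C F r \<omega>) integrable_on {r0..}"
      using cF has_integral_integrable[OF powr] le by (rule continuous_dominated_integrable_Ici)
    show "norm (integral {r0..} (\<lambda>r. cis \<omega> *\<^sub>C F r \<omega>)) \<le> M * (2 * r0 powr (-1/2))"
      using integral_norm_bound_integral[OF i has_integral_integrable[OF powr], unfolded integral_unique[OF powr]] le
      by simp
  qed
  have arc: "(\<lambda>\<omega>. (\<i> * rcis r0 \<omega>) *\<^sub>C F r0 \<omega>) integrable_on {\<alpha>..\<beta>}"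
    "norm (integral {\<alpha>..\<beta>} (\<lambda>\<omega>. (\<i> * rcis r0 \<omega>) *\<^sub>C F r0 \<omega>)) \<le> M * r0 powr (-1/2) * (\<beta> - \<alpha>)"
  proof -
    have "continuous_on {\<alpha>..\<beta>} (\<lambda>\<omega>. (\<lambda>(r, \<omega>). F r \<omega>) (r0, \<omega>))"
      by (rule continuous_on_compose2[OF cont])
        (auto simp: polar_contour_def intro!: continuous_intros)
    then have cF: "continuous_on {\<alpha>..\<beta>} (\<lambda>\<omega>. (\<i> * rcis r0 \<omega>) *\<^sub>C F r0 \<omega>)"
      unfolding rcis_def cis_conv_exp by (intro scaleC.continuous_on continuous_intros) simp
    then show "(\<lambda>\<omega>. (\<i> * rcis r0 \<omega>) *\<^sub>C F r0 \<omega>) integrable_on {\<alpha>..\<beta>}"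
      by (rule integrable_continuous_real)
    have "norm ((\<i> * rcis r0 \<omega>) *\<^sub>C F r0 \<omega>) \<le> M * r0 powr (-1/2)" if "\<omega> \<in> {\<alpha>..\<beta>}" for \<omega>
    proof -
      have "norm ((\<i> * rcis r0 \<omega>) *\<^sub>C F r0 \<omega>) = r0 * norm (F r0 \<omega>)"
        using r0 by (simp add: norm_scaleC norm_mult)
      also have "\<dots> \<le> r0 * (M * r0 powr (-3/2))"
        using bound[of r0 \<omega>] that r0 by (intro mult_left_mono) (auto simp: polar_contour_def)
      also have "\<dots> = M * (r0 powr 1 * r0 powr (-3/2))" using r0 by simp
      also have "\<dots> = M * r0 powr (-1/2)" unfolding powr_add[symmetric] by simp
      finally show ?thesis .
    qed
    then show "norm (integral {\<alpha>..\<beta>} (\<lambda>\<omega>. (\<i> * rcis r0 \<omega>) *\<^sub>C F r0 \<omega>)) \<le> M * r0 powr (-1/2) * (\<beta> - \<alpha>)"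
      by (rule integral_bound[OF \<open>\<alpha> \<le> \<beta>\<close> cF])
  qed
  show "polar_contour_integrable r0 \<beta> \<alpha> F"
    unfolding polar_contour_integrable_def using ray(1) arc(1) by blast
  have "norm (polar_contour_integral r0 \<beta> \<alpha> F) \<le>
      M * (2 * r0 powr (-1/2)) + M * r0 powr (-1/2) * (\<beta> - \<alpha>) + M * (2 * r0 powr (-1/2))"
    unfolding polar_contour_integral_def
    by (intro norm_triangle_le norm_triangle_le_diff add_mono)
      (use ray(2) arc(2) in \<open>simp_all add: norm_minus_cancel\<close>)
  also have "\<dots> = M * ((4 + (\<beta> - \<alpha>)) * r0 powr (-1/2))" by (simp add: algebra_simps)
  finally show "norm (polar_contour_integral r0 \<beta> \<alpha> F) \<le> M * ((4 + (\<beta> - \<alpha>)) * r0 powr (-1/2))" .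
qed

text \<open>The values of the antiderivative at the two corners cancel, and those at infinity vanish.\<close>

lemma polar_contour_antiderivative:
  fixes F P :: "real \<Rightarrow> real \<Rightarrow> 'h::complex_hilbert_space"
  assumes "\<alpha> \<le> \<beta>"
    and ray: "\<And>r \<omega>. r \<ge> r0 \<Longrightarrow> \<omega> \<in> {\<alpha>, \<beta>} \<Longrightarrow>
      ((\<lambda>r. P r \<omega>) has_vector_derivative cis \<omega> *\<^sub>C F r \<omega>) (at r)"
    and arc: "\<And>\<omega>. \<omega> \<in> {\<alpha>..\<beta>} \<Longrightarrow>
      (P r0 has_vector_derivative (\<i> * rcis r0 \<omega>) *\<^sub>C F r0 \<omega>) (at \<omega>)"
    and lim: "\<And>\<omega>. \<omega> \<in> {\<alpha>, \<beta>} \<Longrightarrow> ((\<lambda>r. P r \<omega>) \<longlongrightarrow> 0) at_top"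
  shows "polar_contour_integrable r0 \<beta> \<alpha> F" "polar_contour_integral r0 \<beta> \<alpha> F = 0"
proof -
  have "((\<lambda>r. cis \<omega> *\<^sub>C F r \<omega>) has_integral 0 - P r0 \<omega>) {r0..}" if "\<omega> \<in> {\<alpha>, \<beta>}" for \<omega>
    using that ray lim by (intro fundamental_theorem_of_calculus_Ici) auto
  from this[of \<alpha>] this[of \<beta>]
  have "((\<lambda>r. cis \<alpha> *\<^sub>C F r \<alpha>) has_integral - P r0 \<alpha>) {r0..}"
    "((\<lambda>r. cis \<beta> *\<^sub>C F r \<beta>) has_integral - P r0 \<beta>) {r0..}" by simp_all
  moreover have "((\<lambda>\<omega>. (\<i> * rcis r0 \<omega>) *\<^sub>C F r0 \<omega>) has_integral P r0 \<beta> - P r0 \<alpha>) {\<alpha>..\<beta>}"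
    using assms(1) arc
    by (intro fundamental_theorem_of_calculus) (auto intro: has_vector_derivative_at_within)
  ultimately show "polar_contour_integrable r0 \<beta> \<alpha> F" "polar_contour_integral r0 \<beta> \<alpha> F = 0"
    unfolding polar_contour_integrable_def polar_contour_integral_def
    by (auto simp: integral_unique)
qed

section \<open>Powers and logarithms along the contour\<close>

lemma norm_exp_polar_log: "r > 0 \<Longrightarrow> cmod (exp (- of_real s * polar_log r \<omega>)) = r powr (-s)"
  by (simp add: polar_log_def powr_def)

lemma polar_log_shift: "polar_log r (\<omega> - 2 * pi) = polar_log r \<omega> - 2 * pi * \<i>"
  by (simp add: polar_log_def algebra_simps)

lemma polar_log_growth:
  assumes r0: "r0 > 0" and a: "a > 0"
  obtains K where "K \<ge> 0"
    "\<And>r \<omega>. r \<ge> r0 \<Longrightarrow> \<omega> \<in> {\<alpha>..\<beta>} \<Longrightarrow> cmod (polar_log r \<omega>) \<le> K * r powr a"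
proof
  define c where "c = \<bar>ln r0\<bar> + \<bar>\<alpha>\<bar> + \<bar>\<beta>\<bar>"
  show "c * r0 powr (-a) + 1 / a \<ge> 0" using a by (simp add: c_def)
  fix r \<omega> assume r: "r \<ge> r0" and \<omega>: "\<omega> \<in> {\<alpha>..\<beta>}"
  have "cmod (polar_log r \<omega>) \<le> \<bar>ln r\<bar> + \<bar>\<omega>\<bar>"
    unfolding polar_log_def by (rule norm_triangle_le) (simp add: norm_mult)
  also have "\<bar>ln r\<bar> \<le> \<bar>ln r0\<bar> + r powr a / a"
  proof (cases "r \<ge> 1")
    case True
    then show ?thesis using ln_powr_bound[OF True a] by simp
  next
    case False
    then have "\<bar>ln r\<bar> \<le> \<bar>ln r0\<bar>" using r r0 by simp
    moreover have "r powr a / a \<ge> 0" using a by simp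
    ultimately show ?thesis by linarith
  qed
  also have "\<bar>ln r0\<bar> + r powr a / a + \<bar>\<omega>\<bar> \<le> c * 1 + r powr a / a" using \<omega> by (auto simp: c_def)
  also have "\<dots> \<le> c * (r0 powr (-a) * r powr a) + r powr a / a"
  proof -
    have "1 = r0 powr (-a) * r0 powr a" using r0 by (simp flip: powr_add)
    also have "\<dots> \<le> r0 powr (-a) * r powr a" using r r0 a by (intro mult_left_mono powr_mono2) auto
    finally show ?thesis by (intro add_right_mono mult_left_mono) (auto simp: c_def)
  qed
  also have "\<dots> = (c * r0 powr (-a) + 1 / a) * r powr a" by (simp add: algebra_simps)
  finally show "cmod (polar_log r \<omega>) \<le> (c * r0 powr (-a) + 1 / a) * r powr a" by simp
qed

lemma norm_exp_minus_one_le: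
  assumes "Re z \<le> m" "0 \<le> m"
  shows "cmod (exp z - 1) \<le> exp m * cmod z"
proof -
  have "cmod (exp z - exp 0) \<le> exp m * cmod (z - 0)"
    by (rule field_differentiable_bound[OF convex_halfspace_Re_le[of m], where f' = exp])
      (use assms in \<open>auto intro: DERIV_subset DERIV_exp\<close>)
  then show ?thesis by simp
qed

text \<open>The integrand \<open>\<lambda>\<^sup>-\<^sup>s\<^sup>-\<^sup>1 log \<lambda>\<close> has the antiderivative \<open>- \<lambda>\<^sup>-\<^sup>s (log \<lambda> / s + 1 / s\<^sup>2)\<close> on the
  Riemann surface of the logarithm, and it vanishes at both infinite ends of the contour.  So this
  part of the resolvent drops out for each \<open>s > 0\<close>, before any limit is taken.\<close>

lemma polar_contour_integral_log_power:
  fixes x :: "'h::complex_hilbert_space"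
  assumes r0: "r0 > 0" and "\<alpha> \<le> \<beta>" and s: "s > 0"
  defines "F \<equiv> \<lambda>r \<omega>. (exp (- of_real s * polar_log r \<omega>) * polar_log r \<omega>) *\<^sub>C inverse (rcis r \<omega>) *\<^sub>C x"
  shows "polar_contour_integrable r0 \<beta> \<alpha> F" "polar_contour_integral r0 \<beta> \<alpha> F = 0"
proof -
  define f where "f z = - exp (- of_real s * z) * (z / of_real s + 1 / (of_real s)\<^sup>2)" for z :: complex
  have f: "(f has_field_derivative exp (- of_real s * z) * z) (at z)" for z
    unfolding f_def using s
    by (auto intro!: derivative_eq_intros simp: field_simps power2_eq_square)
  have dr: "((\<lambda>r. polar_log r \<omega>) has_vector_derivative of_real (1 / r)) (at r)" if "r > 0" for r \<omega>
    unfolding polar_log_def has_vector_derivative_def using that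
    by (auto intro!: derivative_eq_intros simp: scaleR_conv_of_real fun_eq_iff divide_inverse)
  have dw: "(polar_log r has_vector_derivative \<i>) (at \<omega>)" for r \<omega>
    unfolding polar_log_def has_vector_derivative_def
    by (auto intro!: derivative_eq_intros simp: scaleR_conv_of_real fun_eq_iff)
  define P where "P r \<omega> = f (polar_log r \<omega>) *\<^sub>C x" for r \<omega>
  have ray: "((\<lambda>r. P r \<omega>) has_vector_derivative cis \<omega> *\<^sub>C F r \<omega>) (at r)" if "r \<ge> r0" for r \<omega>
  proof -
    have r: "r > 0" using that r0 by simp
    have "((\<lambda>r. P r \<omega>) has_vector_derivative
        (of_real (1 / r) * (exp (- of_real s * polar_log r \<omega>) * polar_log r \<omega>)) *\<^sub>C x) (at r)"
      using bounded_linear.has_vector_derivative[OF scaleC.bounded_linear_left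
          field_vector_diff_chain_at[OF dr[OF r] f]]
      by (simp add: P_def o_def)
    moreover have "cis \<omega> *\<^sub>C F r \<omega> =
        (of_real (1 / r) * (exp (- of_real s * polar_log r \<omega>) * polar_log r \<omega>)) *\<^sub>C x"
      using r by (simp add: F_def scaleC_scaleC rcis_def field_simps)
    ultimately show ?thesis by simp
  qed
  have arc: "(P r0 has_vector_derivative (\<i> * rcis r0 \<omega>) *\<^sub>C F r0 \<omega>) (at \<omega>)" for \<omega>
  proof -
    have "(P r0 has_vector_derivative
        (\<i> * (exp (- of_real s * polar_log r0 \<omega>) * polar_log r0 \<omega>)) *\<^sub>C x) (at \<omega>)"
      using bounded_linear.has_vector_derivative[OF scaleC.bounded_linear_left
          field_vector_diff_chain_at[OF dw f]]
      by (simp add: P_def[abs_def] o_def)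
    moreover have "(\<i> * rcis r0 \<omega>) *\<^sub>C F r0 \<omega> =
        (\<i> * (exp (- of_real s * polar_log r0 \<omega>) * polar_log r0 \<omega>)) *\<^sub>C x"
      using r0 by (simp add: F_def scaleC_scaleC rcis_def field_simps)
    ultimately show ?thesis by simp
  qed
  have lim: "((\<lambda>r. P r \<omega>) \<longlongrightarrow> 0) at_top" if \<omega>: "\<omega> \<in> {\<alpha>, \<beta>}" for \<omega>
  proof -
    obtain K where K: "K \<ge> 0"
        "\<And>r \<omega>. r \<ge> r0 \<Longrightarrow> \<omega> \<in> {\<alpha>..\<beta>} \<Longrightarrow> cmod (polar_log r \<omega>) \<le> K * r powr (s / 2)"
      using polar_log_growth[OF r0, of "s / 2" \<alpha> \<beta>] s by auto
    have "((\<lambda>r. K / s * r powr (- (s / 2)) + 1 / s\<^sup>2 * r powr (- s)) \<longlongrightarrow> K / s * 0 + 1 / s\<^sup>2 * 0) at_top"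
      using s by (intro tendsto_intros tendsto_neg_powr filterlim_ident) auto
    then have lim: "((\<lambda>r. K / s * r powr (- (s / 2)) + 1 / s\<^sup>2 * r powr (- s)) \<longlongrightarrow> 0) at_top"
      by simp
    have "\<forall>\<^sub>F r in at_top. norm (f (polar_log r \<omega>)) \<le>
        K / s * r powr (- (s / 2)) + 1 / s\<^sup>2 * r powr (- s)"
      using eventually_ge_at_top[of r0]
    proof eventually_elim
      case (elim r)
      then have r: "r > 0" using r0 by simp
      have "cmod (polar_log r \<omega>) \<le> K * r powr (s / 2)" using K(2)[OF elim] \<omega> \<open>\<alpha> \<le> \<beta>\<close> by auto
      then have "cmod (polar_log r \<omega> / of_real s + 1 / (of_real s)\<^sup>2) \<le> K * r powr (s / 2) / s + 1 / s\<^sup>2"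
        using s by (intro norm_triangle_le add_mono) (auto simp: norm_divide norm_power divide_right_mono)
      then have "norm (f (polar_log r \<omega>)) \<le> r powr (-s) * (K * r powr (s / 2) / s + 1 / s\<^sup>2)"
        using norm_exp_polar_log[OF r, of s \<omega>] by (simp add: f_def norm_mult mult_left_mono)
      also have "\<dots> = K / s * (r powr (-s) * r powr (s / 2)) + 1 / s\<^sup>2 * r powr (-s)"
        by (simp add: algebra_simps)
      also have "r powr (-s) * r powr (s / 2) = r powr (- (s / 2))"
        by (simp flip: powr_add)
      finally show ?case .
    qed
    from Lim_null_comparison[OF this lim] have "((\<lambda>r. f (polar_log r \<omega>)) \<longlongrightarrow> 0) at_top" .
    then show ?thesis
      unfolding P_def by (rule scaleC.tendsto_left_zero)
  qed
  show "polar_contour_integrable r0 \<beta> \<alpha> F" "polar_contour_integral r0 \<beta> \<alpha> F = 0"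
    by (rule polar_contour_antiderivative[where P = P]; use \<open>\<alpha> \<le> \<beta>\<close> ray arc lim in blast)+
qed

section \<open>The logarithm on the domain of the operator\<close>

text \<open>On the contour \<open>cmod (\<lambda>\<^sup>-\<^sup>s - 1) \<le> const * s * cmod (log \<lambda>)\<close> for \<open>0 < s < 1\<close>, and
  \<open>(log \<lambda>)\<^sup>2 * \<lambda>\<^sup>-\<^sup>2\<close> is absolutely integrable there; so the two integrals differ by \<open>O(s)\<close>.\<close>

lemma polar_contour_log_limit:
  fixes G :: "real \<Rightarrow> real \<Rightarrow> 'h::complex_hilbert_space"
  assumes r0: "r0 > 0" and "\<alpha> \<le> \<beta>"
    and cont: "continuous_on (polar_contour r0 \<beta> \<alpha>) (\<lambda>(r, \<omega>). G r \<omega>)"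
    and bound: "\<And>r \<omega>. (r, \<omega>) \<in> polar_contour r0 \<beta> \<alpha> \<Longrightarrow> norm (G r \<omega>) \<le> M * r powr (-2)"
  defines "H \<equiv> \<lambda>s r \<omega>. (exp (- of_real s * polar_log r \<omega>) * polar_log r \<omega>) *\<^sub>C G r \<omega>"
  shows "s \<ge> 0 \<Longrightarrow> polar_contour_integrable r0 \<beta> \<alpha> (H s)"
    and "((\<lambda>s. polar_contour_integral r0 \<beta> \<alpha> (H s)) \<longlongrightarrow>
      polar_contour_integral r0 \<beta> \<alpha> (H 0)) (at_right 0)"
proof -
  have pos: "r > 0" "r \<ge> r0" "\<omega> \<in> {\<alpha>..\<beta>}" if "(r, \<omega>) \<in> polar_contour r0 \<beta> \<alpha>" for r \<omega>
    using that r0 \<open>\<alpha> \<le> \<beta>\<close> by (auto simp: polar_contour_def)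
  have M: "M \<ge> 0"
  proof -
    have "0 \<le> norm (G r0 \<alpha>)" by simp
    also have "\<dots> \<le> M * r0 powr (-2)" using bound[of r0 \<alpha>] by (simp add: polar_contour_def)
    finally show ?thesis using r0 by (simp add: zero_le_mult_iff)
  qed
  have cont_log: "continuous_on (polar_contour r0 \<beta> \<alpha>) (\<lambda>(r, \<omega>). polar_log r \<omega>)"
    unfolding polar_log_def case_prod_unfold
    using pos(1) by (intro continuous_intros) (metis less_irrefl prod.collapse)
  have cont_H: "continuous_on (polar_contour r0 \<beta> \<alpha>) (\<lambda>(r, \<omega>). H s r \<omega>)" for s
    using cont cont_log unfolding H_def case_prod_unfold
    by (intro scaleC.continuous_on continuous_intros)
  show int: "polar_contour_integrable r0 \<beta> \<alpha> (H s)" if "s \<ge> 0" for s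
  proof -
    obtain K where K: "K \<ge> 0"
        "\<And>r \<omega>. r \<ge> r0 \<Longrightarrow> \<omega> \<in> {\<alpha>..\<beta>} \<Longrightarrow> cmod (polar_log r \<omega>) \<le> K * r powr (1 / 2)"
      using polar_log_growth[OF r0, of "1 / 2" \<alpha> \<beta>] by auto
    show ?thesis
    proof (rule polar_contour_dominated(1)[OF r0 \<open>\<alpha> \<le> \<beta>\<close> cont_H, where M = "r0 powr (-s) * K * M"])
      fix r \<omega> assume c: "(r, \<omega>) \<in> polar_contour r0 \<beta> \<alpha>"
      have "norm (H s r \<omega>) = r powr (-s) * cmod (polar_log r \<omega>) * norm (G r \<omega>)"
        using norm_exp_polar_log[OF pos(1)[OF c], of s \<omega>] by (simp add: H_def norm_scaleC norm_mult)
      also have "\<dots> \<le> r0 powr (-s) * (K * r powr (1 / 2)) * (M * r powr (-2))"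
        using pos[OF c] K c bound r0 \<open>s \<ge> 0\<close> M
        by (intro mult_mono powr_mono2') auto
      also have "\<dots> = r0 powr (-s) * K * M * (r powr (1 / 2) * r powr (-2))" by simp
      also have "r powr (1 / 2) * r powr (-2) = r powr (-3/2)" by (simp flip: powr_add)
      finally show "norm (H s r \<omega>) \<le> r0 powr (-s) * K * M * r powr (-3/2)" .
    qed
  qed
  \<comment> \<open>The exponent \<open>1 / 4\<close> makes the square of the logarithm at most \<open>r powr (1 / 2)\<close>, which leaves
    the integrable decay \<open>r powr (-3/2)\<close>.\<close>
  obtain K where K: "K \<ge> 0"
      "\<And>r \<omega>. r \<ge> r0 \<Longrightarrow> \<omega> \<in> {\<alpha>..\<beta>} \<Longrightarrow> cmod (polar_log r \<omega>) \<le> K * r powr (1 / 4)"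
    using polar_log_growth[OF r0, of "1 / 4" \<alpha> \<beta>] by auto
  \<comment> \<open>\<open>exp m\<close> bounds \<open>\<lambda>\<^sup>-\<^sup>s\<close> for \<open>0 < s < 1\<close>; it exceeds 1 when \<open>r0 < 1\<close>.\<close>
  define m where "m = max 0 (- ln r0)"
  define B where "B = exp m * K\<^sup>2 * M"
  define C where "C = B * ((4 + (\<beta> - \<alpha>)) * r0 powr (-1/2))"
  have rate: "norm (polar_contour_integral r0 \<beta> \<alpha> (H s) - polar_contour_integral r0 \<beta> \<alpha> (H 0)) \<le> s * C"
    if s: "0 < s" "s < 1" for s
  proof -
    have "norm (polar_contour_integral r0 \<beta> \<alpha> (\<lambda>r \<omega>. H s r \<omega> - H 0 r \<omega>)) \<le>
        s * B * ((4 + (\<beta> - \<alpha>)) * r0 powr (-1/2))"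
    proof (rule polar_contour_dominated(2)[OF r0 \<open>\<alpha> \<le> \<beta>\<close>])
      show "continuous_on (polar_contour r0 \<beta> \<alpha>) (\<lambda>(r, \<omega>). H s r \<omega> - H 0 r \<omega>)"
        using continuous_on_diff[OF cont_H[of s] cont_H[of 0]] by (simp add: case_prod_unfold)
      fix r \<omega> assume c: "(r, \<omega>) \<in> polar_contour r0 \<beta> \<alpha>"
      let ?L = "polar_log r \<omega>"
      have "- ln r \<le> m" using pos[OF c] r0 by (simp add: m_def max.coboundedI2)
      then have "- s * ln r \<le> s * m" using mult_left_mono[of "- ln r" m s] s(1) by simp
      also have "\<dots> \<le> m" using s by (simp add: m_def mult_left_le_one_le)
      finally have "Re (- of_real s * ?L) \<le> m" by (simp add: polar_log_def)
      then have "cmod (exp (- of_real s * ?L) - 1) \<le> exp m * cmod (- of_real s * ?L)"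
        by (rule norm_exp_minus_one_le) (simp add: m_def)
      then have e: "cmod (exp (- of_real s * ?L) - 1) \<le> exp m * (s * cmod ?L)"
        using s by (simp add: norm_mult)
      have "H s r \<omega> - H 0 r \<omega> = ((exp (- of_real s * ?L) - 1) * ?L) *\<^sub>C G r \<omega>"
        by (simp add: H_def algebra_simps scaleC.diff_left)
      then have "norm (H s r \<omega> - H 0 r \<omega>) = cmod (exp (- of_real s * ?L) - 1) * cmod ?L * norm (G r \<omega>)"
        by (simp add: norm_scaleC norm_mult)
      also have "\<dots> \<le> exp m * (s * (K * r powr (1 / 4))) * (K * r powr (1 / 4)) * (M * r powr (-2))"
        using pos[OF c] K s M
        by (intro mult_mono order_trans[OF e] mult_left_mono bound[OF c]) auto
      also have "\<dots> = s * B * (r powr (1 / 4) * r powr (1 / 4) * r powr (-2))"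
        by (simp add: B_def power2_eq_square mult_ac)
      also have "r powr (1 / 4) * r powr (1 / 4) * r powr (-2) = r powr (-3/2)"
        by (simp flip: powr_add)
      finally show "norm (H s r \<omega> - H 0 r \<omega>) \<le> s * B * r powr (-3/2)" .
    qed
    then show ?thesis
      using polar_contour_diff(2)[OF int[of s] int[of 0]] s by (simp add: C_def mult.assoc)
  qed
  have "((\<lambda>s. s * C) \<longlongrightarrow> 0 * C) (at_right 0)" by (intro tendsto_intros)
  then have lim: "((\<lambda>s. s * C) \<longlongrightarrow> 0) (at_right 0)" by simp
  have "\<forall>\<^sub>F s in at_right 0.
      norm (polar_contour_integral r0 \<beta> \<alpha> (H s) - polar_contour_integral r0 \<beta> \<alpha> (H 0)) \<le> s * C"
    using eventually_at_right_real[OF zero_less_one] by (rule eventually_mono) (simp add: rate)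
  from Lim_null_comparison[OF this lim]
  show "((\<lambda>s. polar_contour_integral r0 \<beta> \<alpha> (H s)) \<longlongrightarrow>
      polar_contour_integral r0 \<beta> \<alpha> (H 0)) (at_right 0)"
    by (rule LIM_zero_cancel)
qed

text \<open>The growth condition only controls large \<open>r\<close>; on the remaining compact piece of the ray the
  resolvent is bounded by continuity.\<close>

lemma resolvent_decay_on_ray:
  assumes lin: "clinear_operator D A" and "r0 > 0"
    and ray: "\<And>r. r \<ge> r0 \<Longrightarrow> rcis r \<omega> \<in> resolvent_set D A"
    and bigo: "(\<lambda>r. onorm (resolvent D A (rcis r \<omega>))) \<in> O[at_top](\<lambda>r. 1 / r)"
  obtains M where "\<And>r. r \<ge> r0 \<Longrightarrow> norm (resolvent D A (rcis r \<omega>) y) \<le> M * r powr (-1)"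
proof -
  obtain c where c: "c > 0" "\<forall>\<^sub>F r in at_top. norm (onorm (resolvent D A (rcis r \<omega>))) \<le> c * norm (1 / r)"
    by (rule landau_o.bigE[OF bigo])
  then obtain N where N: "\<And>r. r \<ge> N \<Longrightarrow> norm (onorm (resolvent D A (rcis r \<omega>))) \<le> c * norm (1 / r)"
    unfolding eventually_at_top_linorder by blast
  have "continuous_on {r0..N} (\<lambda>r. resolvent D A (rcis r \<omega>) y)"
    by (rule continuous_on_compose2[OF continuous_on_resolvent[OF lin]])
      (use ray in \<open>auto simp: rcis_def intro!: continuous_intros\<close>)
  then have "continuous_on {r0..N} (\<lambda>r. r *\<^sub>R resolvent D A (rcis r \<omega>) y)"
    by (intro continuous_on_scaleR continuous_on_id)
  then have "bounded ((\<lambda>r. r *\<^sub>R resolvent D A (rcis r \<omega>) y) ` {r0..N})"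
    by (intro compact_imp_bounded compact_continuous_image) auto
  then obtain B where B: "\<And>r. r \<in> {r0..N} \<Longrightarrow> norm (r *\<^sub>R resolvent D A (rcis r \<omega>) y) \<le> B"
    unfolding bounded_iff by blast
  show ?thesis
  proof (rule that[of "max B (c * norm y)"])
    fix r assume r: "r \<ge> r0"
    then have "r > 0" using \<open>r0 > 0\<close> by simp
    have "r * norm (resolvent D A (rcis r \<omega>) y) \<le> max B (c * norm y)"
    proof (cases "r \<le> N")
      case True
      then show ?thesis using B[of r] r \<open>r > 0\<close> by simp
    next
      case False
      have "norm (resolvent D A (rcis r \<omega>) y) \<le> onorm (resolvent D A (rcis r \<omega>)) * norm y"
        by (intro onorm bounded_linear_resolvent ray r)
      also have "\<dots> \<le> c / r * norm y"
        using N[of r] False \<open>r > 0\<close> by (intro mult_right_mono) auto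
      finally show ?thesis using \<open>r > 0\<close> by (simp add: field_simps)
    qed
    then show "norm (resolvent D A (rcis r \<omega>) y) \<le> max B (c * norm y) * r powr (-1)"
      using \<open>r > 0\<close> by (simp add: powr_minus_divide field_simps)
  qed
qed

lemma continuous_on_polar_resolvent:
  assumes lin: "clinear_operator D A"
    and spec: "\<And>r \<omega>. (r, \<omega>) \<in> S \<Longrightarrow> rcis r \<omega> \<in> resolvent_set D A"
  shows "continuous_on S (\<lambda>(r, \<omega>). resolvent D A (rcis r \<omega>) y)"
  unfolding case_prod_unfold
  by (rule continuous_on_compose2[OF continuous_on_resolvent[OF lin]])
    (use spec in \<open>auto simp: rcis_def cis_conv_exp intro!: continuous_intros\<close>)

lemma resolvent_decay_on_contour:
  assumes lin: "clinear_operator D A" and r0: "r0 > 0"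
    and spec: "\<And>r \<omega>. (r, \<omega>) \<in> polar_contour r0 \<beta> \<alpha> \<Longrightarrow> rcis r \<omega> \<in> resolvent_set D A"
    and bigo: "\<And>\<omega>. \<omega> \<in> {\<alpha>, \<beta>} \<Longrightarrow>
      (\<lambda>r. onorm (resolvent D A (rcis r \<omega>))) \<in> O[at_top](\<lambda>r. 1 / r)"
  obtains M where "\<And>r \<omega>. (r, \<omega>) \<in> polar_contour r0 \<beta> \<alpha> \<Longrightarrow>
    norm (resolvent D A (rcis r \<omega>) y) \<le> M * r powr (-1)"
proof -
  have ray: "\<exists>M. \<forall>r\<ge>r0. norm (resolvent D A (rcis r \<omega>) y) \<le> M * r powr (-1)" if "\<omega> \<in> {\<alpha>, \<beta>}" for \<omega>
  proof -
    have "rcis r \<omega> \<in> resolvent_set D A" if "r \<ge> r0" for r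
      using spec that \<open>\<omega> \<in> {\<alpha>, \<beta>}\<close> by (auto simp: polar_contour_def)
    from resolvent_decay_on_ray[OF lin r0 this bigo[OF that], of y] show ?thesis by blast
  qed
  obtain M1 M2 where M12: "\<And>r. r \<ge> r0 \<Longrightarrow> norm (resolvent D A (rcis r \<alpha>) y) \<le> M1 * r powr (-1)"
      "\<And>r. r \<ge> r0 \<Longrightarrow> norm (resolvent D A (rcis r \<beta>) y) \<le> M2 * r powr (-1)"
    using ray[of \<alpha>] ray[of \<beta>] by auto
  have "compact ({r0} \<times> {\<alpha>..\<beta>})" by (intro compact_Times) auto
  then have "bounded ((\<lambda>(r, \<omega>). resolvent D A (rcis r \<omega>) y) ` ({r0} \<times> {\<alpha>..\<beta>}))"
    by (intro compact_imp_bounded compact_continuous_image continuous_on_polar_resolvent[OF lin] spec)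
      (auto simp: polar_contour_def)
  then obtain B where "\<forall>z\<in>(\<lambda>(r, \<omega>). resolvent D A (rcis r \<omega>) y) ` ({r0} \<times> {\<alpha>..\<beta>}). norm z \<le> B"
    unfolding bounded_iff by blast
  then have B: "norm (resolvent D A (rcis r0 \<omega>) y) \<le> B" if "\<omega> \<in> {\<alpha>..\<beta>}" for \<omega>
    using that by auto
  define M where "M = Max {M1, M2, B * r0}"
  have M: "M1 \<le> M" "M2 \<le> M" "B * r0 \<le> M" by (auto simp: M_def)
  show ?thesis
  proof (rule that[of M])
    fix r \<omega> assume c: "(r, \<omega>) \<in> polar_contour r0 \<beta> \<alpha>"
    then consider "r \<ge> r0" "\<omega> = \<alpha>" | "r \<ge> r0" "\<omega> = \<beta>" | "r = r0" "\<omega> \<in> {\<alpha>..\<beta>}"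
      unfolding polar_contour_def by blast
    then show "norm (resolvent D A (rcis r \<omega>) y) \<le> M * r powr (-1)"
    proof cases
      case 1
      then show ?thesis using order_trans[OF M12(1) mult_right_mono[OF M(1)]] by simp
    next
      case 2
      then show ?thesis using order_trans[OF M12(2) mult_right_mono[OF M(2)]] by simp
    next
      case 3
      have "norm (resolvent D A (rcis r0 \<omega>) y) \<le> B * r0 * r0 powr (-1)"
        using B[OF 3(2)] r0 by (simp add: powr_minus_divide)
      also have "\<dots> \<le> M * r0 powr (-1)" using M(3) by (intro mult_right_mono) auto
      finally show ?thesis using 3(1) by simp
    qed
  qed
qed

lemma polar_contour_inverse_resolvent:
  fixes D :: "'h::complex_hilbert_space set" and y :: 'h
  assumes lin: "clinear_operator D A" and r0: "r0 > 0" and "\<alpha> \<le> \<beta>"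
    and spec: "\<And>r \<omega>. (r, \<omega>) \<in> polar_contour r0 \<beta> \<alpha> \<Longrightarrow> rcis r \<omega> \<in> resolvent_set D A"
    and bigo: "\<And>\<omega>. \<omega> \<in> {\<alpha>, \<beta>} \<Longrightarrow>
      (\<lambda>r. onorm (resolvent D A (rcis r \<omega>))) \<in> O[at_top](\<lambda>r. 1 / r)"
  defines "G \<equiv> \<lambda>r \<omega>. inverse (rcis r \<omega>) *\<^sub>C resolvent D A (rcis r \<omega>) y"
  shows "continuous_on (polar_contour r0 \<beta> \<alpha>) (\<lambda>(r, \<omega>). G r \<omega>)"
    and "\<exists>M. \<forall>r \<omega>. (r, \<omega>) \<in> polar_contour r0 \<beta> \<alpha> \<longrightarrow> norm (G r \<omega>) \<le> M * r powr (-2)"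
    and "polar_contour_integrable r0 \<beta> \<alpha> G"
proof -
  have pos: "r > 0" "r \<ge> r0" if "(r, \<omega>) \<in> polar_contour r0 \<beta> \<alpha>" for r \<omega>
    using that r0 by (auto simp: polar_contour_def)
  have nz: "fst p \<noteq> 0" if "p \<in> polar_contour r0 \<beta> \<alpha>" for p
    using pos(1)[of "fst p" "snd p"] that by auto
  have "continuous_on (polar_contour r0 \<beta> \<alpha>) (\<lambda>p. inverse (rcis (fst p) (snd p)))"
    unfolding rcis_def cis_conv_exp using nz by (intro continuous_intros) auto
  then show cont: "continuous_on (polar_contour r0 \<beta> \<alpha>) (\<lambda>(r, \<omega>). G r \<omega>)"
    using continuous_on_polar_resolvent[OF lin spec] unfolding G_def case_prod_unfold
    by (rule scaleC.continuous_on)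
  obtain M where M: "\<And>r \<omega>. (r, \<omega>) \<in> polar_contour r0 \<beta> \<alpha> \<Longrightarrow>
      norm (resolvent D A (rcis r \<omega>) y) \<le> M * r powr (-1)"
    using resolvent_decay_on_contour[OF lin r0 spec bigo] by blast
  have bound: "norm (G r \<omega>) \<le> M * r powr (-2)" if c: "(r, \<omega>) \<in> polar_contour r0 \<beta> \<alpha>" for r \<omega>
  proof -
    have "norm (G r \<omega>) = r powr (-1) * norm (resolvent D A (rcis r \<omega>) y)"
      using pos[OF c] by (simp add: G_def norm_scaleC norm_divide powr_minus_divide inverse_eq_divide)
    also have "\<dots> \<le> r powr (-1) * (M * r powr (-1))"
      using M[OF c] by (intro mult_left_mono) auto
    also have "\<dots> = M * (r powr (-1) * r powr (-1))" by simp
    also have "r powr (-1) * r powr (-1) = r powr (-2)" unfolding powr_add[symmetric] by simp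
    finally show ?thesis .
  qed
  then show "\<exists>M. \<forall>r \<omega>. (r, \<omega>) \<in> polar_contour r0 \<beta> \<alpha> \<longrightarrow> norm (G r \<omega>) \<le> M * r powr (-2)"
    by blast
  have "M \<ge> 0"
  proof -
    have "0 \<le> norm (G r0 \<alpha>)" by simp
    also have "\<dots> \<le> M * r0 powr (-2)" using bound[of r0 \<alpha>] by (simp add: polar_contour_def)
    finally show ?thesis using r0 by (simp add: zero_le_mult_iff)
  qed
  show "polar_contour_integrable r0 \<beta> \<alpha> G"
  proof (rule polar_contour_dominated(1)[OF r0 \<open>\<alpha> \<le> \<beta>\<close> cont, where M = "M * r0 powr (-1/2)"])
    fix r \<omega> assume c: "(r, \<omega>) \<in> polar_contour r0 \<beta> \<alpha>"
    have "r powr (-2) = r powr (-1/2) * r powr (-3/2)" by (simp flip: powr_add)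
    also have "\<dots> \<le> r0 powr (-1/2) * r powr (-3/2)"
      using pos[OF c] r0 by (intro mult_right_mono powr_mono2') auto
    finally have "M * r powr (-2) \<le> M * (r0 powr (-1/2) * r powr (-3/2))"
      using \<open>M \<ge> 0\<close> by (rule mult_left_mono)
    with bound[OF c] show "norm (G r \<omega>) \<le> M * r0 powr (-1/2) * r powr (-3/2)" by simp
  qed
qed

text \<open>On the contour \<open>R(\<lambda>) x = \<lambda>\<^sup>-\<^sup>1 R(\<lambda>) A x - \<lambda>\<^sup>-\<^sup>1 x\<close>.  The second term contributes nothing for any
  \<open>s > 0\<close>; the first decays like \<open>\<lambda>\<^sup>-\<^sup>2\<close>, so that \<open>s = 0\<close> may be inserted under the integral.\<close>

theorem op_log_on_domain:
  fixes D :: "'h::complex_hilbert_space set"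
  assumes lin: "clinear_operator D A" and r0: "r0 > 0" and x: "x \<in> D"
    and spec: "\<And>r \<omega>. (r, \<omega>) \<in> polar_contour r0 \<theta> (\<theta> - 2 * pi) \<Longrightarrow> rcis r \<omega> \<in> resolvent_set D A"
    and bigo: "(\<lambda>r. onorm (resolvent D A (rcis r \<theta>))) \<in> O[at_top](\<lambda>r. 1 / r)"
  defines "F \<equiv> \<lambda>r \<omega>. polar_log r \<omega> *\<^sub>C inverse (rcis r \<omega>) *\<^sub>C resolvent D A (rcis r \<omega>) (A x)"
  shows "polar_contour_integrable r0 \<theta> (\<theta> - 2 * pi) F" and "op_log_defined D A r0 \<theta> x"
    and "op_log D A r0 \<theta> x = (\<i> / (2 * pi)) *\<^sub>C polar_contour_integral r0 \<theta> (\<theta> - 2 * pi) F"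
proof -
  let ?\<alpha> = "\<theta> - 2 * pi"
  have le: "?\<alpha> \<le> \<theta>" by simp
  have pos: "r > 0" if "(r, \<omega>) \<in> polar_contour r0 \<theta> ?\<alpha>" for r \<omega>
    using that r0 by (auto simp: polar_contour_def)
  have bigo': "(\<lambda>r. onorm (resolvent D A (rcis r \<omega>))) \<in> O[at_top](\<lambda>r. 1 / r)"
    if "\<omega> \<in> {?\<alpha>, \<theta>}" for \<omega> using that bigo by (auto simp: rcis_minus_2pi)
  define G where "G r \<omega> = inverse (rcis r \<omega>) *\<^sub>C resolvent D A (rcis r \<omega>) (A x)" for r \<omega>
  define H where "H s r \<omega> = (exp (- of_real s * polar_log r \<omega>) * polar_log r \<omega>) *\<^sub>C G r \<omega>" for s r \<omega>
  define E where "E s r \<omega> =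
    (exp (- of_real s * polar_log r \<omega>) * polar_log r \<omega>) *\<^sub>C inverse (rcis r \<omega>) *\<^sub>C x" for s r \<omega>
  note G = polar_contour_inverse_resolvent[OF lin r0 le spec bigo', of "A x", folded G_def]
  obtain M where M: "\<And>r \<omega>. (r, \<omega>) \<in> polar_contour r0 \<theta> ?\<alpha> \<Longrightarrow> norm (G r \<omega>) \<le> M * r powr (-2)"
    using G(2) by blast
  note H = polar_contour_log_limit[OF r0 le G(1) M, folded H_def]
  note E = polar_contour_integral_log_power[OF r0 le, of _ x, folded E_def]
  have F: "F = H 0" by (intro ext) (simp add: F_def H_def G_def)
  show "polar_contour_integrable r0 \<theta> ?\<alpha> F" unfolding F by (rule H(1)) auto
  have split: "log_integrand D A s x r \<omega> = H s r \<omega> - E s r \<omega>"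
    if "(r, \<omega>) \<in> polar_contour r0 \<theta> ?\<alpha>" for s r \<omega>
    unfolding log_integrand_def H_def E_def G_def
    using resolvent_on_domain[OF lin spec[OF that] x] pos[OF that]
    by (simp add: scaleC.diff_right)
  have int: "polar_contour_integrable r0 \<theta> ?\<alpha> (log_integrand D A s x)" if "s > 0" for s
    using polar_contour_cong(1)[OF split] polar_contour_diff(1)[OF H(1) E(1)] that by simp
  have "log_approx D A r0 \<theta> s x = (\<i> / (2 * pi)) *\<^sub>C polar_contour_integral r0 \<theta> ?\<alpha> (H s)" if "s > 0" for s
    using polar_contour_cong(2)[of r0 \<theta> ?\<alpha> "log_integrand D A s x" "\<lambda>r \<omega>. H s r \<omega> - E s r \<omega>", OF split]
      polar_contour_diff(2)[OF H(1) E(1), of s s] E(2)[of s] that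
    by (simp add: log_approx_def)
  then have ev: "\<forall>\<^sub>F s in at_right 0.
      (\<i> / (2 * pi)) *\<^sub>C polar_contour_integral r0 \<theta> ?\<alpha> (H s) = log_approx D A r0 \<theta> s x"
    using eventually_at_right_less[of 0] by (auto elim!: eventually_mono)
  have lim: "((\<lambda>s. log_approx D A r0 \<theta> s x) \<longlongrightarrow>
      (\<i> / (2 * pi)) *\<^sub>C polar_contour_integral r0 \<theta> ?\<alpha> F) (at_right 0)"
    unfolding F by (rule Lim_transform_eventually[OF scaleC.tendsto[OF tendsto_const H(2)] ev])
  with int show "op_log_defined D A r0 \<theta> x" unfolding op_log_defined_def by blast
  show "op_log D A r0 \<theta> x = (\<i> / (2 * pi)) *\<^sub>C polar_contour_integral r0 \<theta> ?\<alpha> F"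
    unfolding op_log_def by (rule tendsto_Lim[OF trivial_limit_at_right_real lim])
qed

section \<open>Comparing two branches\<close>

text \<open>On the two edges of the cut the logarithms differ by \<open>2 * pi * \<i>\<close>, so only the single-valued
  factor survives on the ray.\<close>

lemma polar_contour_log_collapse:
  fixes G :: "real \<Rightarrow> real \<Rightarrow> 'h::complex_hilbert_space"
  assumes per: "\<And>r \<omega>. G r (\<omega> - 2 * pi) = G r \<omega>"
    and G: "(\<lambda>r. cis \<theta> *\<^sub>C G r \<theta>) integrable_on {r0..}"
    and F: "polar_contour_integrable r0 \<theta> (\<theta> - 2 * pi) (\<lambda>r \<omega>. polar_log r \<omega> *\<^sub>C G r \<omega>)"
  shows "polar_contour_integral r0 \<theta> (\<theta> - 2 * pi) (\<lambda>r \<omega>. polar_log r \<omega> *\<^sub>C G r \<omega>) =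
    - ((2 * pi * \<i>) *\<^sub>C integral {r0..} (\<lambda>r. cis \<theta> *\<^sub>C G r \<theta>))
    - integral {\<theta> - 2 * pi..\<theta>} (\<lambda>\<omega>. (\<i> * rcis r0 \<omega>) *\<^sub>C polar_log r0 \<omega> *\<^sub>C G r0 \<omega>)"
proof -
  have "cis (\<theta> - 2 * pi) *\<^sub>C polar_log r (\<theta> - 2 * pi) *\<^sub>C G r (\<theta> - 2 * pi) =
      cis \<theta> *\<^sub>C polar_log r \<theta> *\<^sub>C G r \<theta> - (2 * pi * \<i>) *\<^sub>C cis \<theta> *\<^sub>C G r \<theta>" for r
    unfolding per cis_minus_2pi polar_log_shift
    by (simp add: scaleC.diff_left scaleC.diff_right scaleC_scaleC mult_ac)
  then have "integral {r0..} (\<lambda>r. cis (\<theta> - 2 * pi) *\<^sub>C polar_log r (\<theta> - 2 * pi) *\<^sub>C G r (\<theta> - 2 * pi)) =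
      integral {r0..} (\<lambda>r. cis \<theta> *\<^sub>C polar_log r \<theta> *\<^sub>C G r \<theta>)
      - (2 * pi * \<i>) *\<^sub>C integral {r0..} (\<lambda>r. cis \<theta> *\<^sub>C G r \<theta>)"
    using F integral_scaleC[OF G] by (simp add: integral_diff polar_contour_integrable_def)
  then show ?thesis unfolding polar_contour_integral_def by simp
qed

text \<open>The circles from \<open>\<theta> - 2 * pi\<close> to \<open>\<theta>\<close> and from \<open>\<phi> - 2 * pi\<close> to \<open>\<phi>\<close> overlap, on the Riemann surface
  of the logarithm, in the arc from \<open>\<phi> - 2 * pi\<close> to \<open>\<theta>\<close>; the two remaining arcs lie one sheet apart.\<close>

lemma polar_contour_log_branch_difference:
  fixes G :: "real \<Rightarrow> real \<Rightarrow> 'h::complex_hilbert_space"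
  assumes le: "\<theta> \<le> \<phi>" "\<phi> \<le> \<theta> + 2 * pi"
    and per: "\<And>r \<omega>. G r (\<omega> - 2 * pi) = G r \<omega>"
    and G: "polar_contour_integrable r0 \<phi> \<theta> G"
  defines "F \<equiv> \<lambda>r \<omega>. polar_log r \<omega> *\<^sub>C G r \<omega>"
  assumes F: "polar_contour_integrable r0 \<theta> (\<theta> - 2 * pi) F" "polar_contour_integrable r0 \<phi> (\<phi> - 2 * pi) F"
  shows "polar_contour_integral r0 \<theta> (\<theta> - 2 * pi) F - polar_contour_integral r0 \<phi> (\<phi> - 2 * pi) F =
    - ((2 * pi * \<i>) *\<^sub>C polar_contour_integral r0 \<phi> \<theta> G)"
proof -
  define f where "f \<omega> = (\<i> * rcis r0 \<omega>) *\<^sub>C F r0 \<omega>" for \<omega>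
  define g where "g \<omega> = (\<i> * rcis r0 \<omega>) *\<^sub>C G r0 \<omega>" for \<omega>
  have collapse: "polar_contour_integral r0 \<theta> (\<theta> - 2 * pi) F =
      - ((2 * pi * \<i>) *\<^sub>C integral {r0..} (\<lambda>r. cis \<theta> *\<^sub>C G r \<theta>)) - integral {\<theta> - 2 * pi..\<theta>} f"
    "polar_contour_integral r0 \<phi> (\<phi> - 2 * pi) F =
      - ((2 * pi * \<i>) *\<^sub>C integral {r0..} (\<lambda>r. cis \<phi> *\<^sub>C G r \<phi>)) - integral {\<phi> - 2 * pi..\<phi>} f"
    using polar_contour_log_collapse[where G = G, OF per _ F(1)[unfolded F_def]]
      polar_contour_log_collapse[where G = G, OF per _ F(2)[unfolded F_def]] G
    by (simp_all add: F_def f_def[abs_def] polar_contour_integrable_def)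
  have PG: "polar_contour_integral r0 \<phi> \<theta> G =
      - integral {r0..} (\<lambda>r. cis \<phi> *\<^sub>C G r \<phi>) - integral {\<theta>..\<phi>} g
      + integral {r0..} (\<lambda>r. cis \<theta> *\<^sub>C G r \<theta>)"
    by (simp add: polar_contour_integral_def g_def[abs_def])
  have fi: "f integrable_on {\<theta> - 2 * pi..\<theta>}" "f integrable_on {\<phi> - 2 * pi..\<phi>}"
    using F unfolding polar_contour_integrable_def f_def by auto
  have gi: "g integrable_on {\<theta>..\<phi>}"
    using G unfolding polar_contour_integrable_def g_def by auto
  have fi': "f integrable_on {\<theta>..\<phi>}"
    by (rule integrable_on_subinterval[OF fi(2)]) (use le in auto)
  have "integral {\<phi> - 2 * pi..\<phi>} f = integral {\<phi> - 2 * pi..\<theta>} f + integral {\<theta>..\<phi>} f"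
    using le fi by (intro Henstock_Kurzweil_Integration.integral_combine[symmetric]) auto
  moreover have "integral {\<theta> - 2 * pi..\<theta>} f =
      integral {\<theta> - 2 * pi..\<phi> - 2 * pi} f + integral {\<phi> - 2 * pi..\<theta>} f"
    using le fi by (intro Henstock_Kurzweil_Integration.integral_combine[symmetric]) auto
  moreover have "integral {\<theta> - 2 * pi..\<phi> - 2 * pi} f =
      integral {\<theta>..\<phi>} f - (2 * pi * \<i>) *\<^sub>C integral {\<theta>..\<phi>} g"
  proof -
    have shift: "f (\<omega> - 2 * pi) = f \<omega> - (2 * pi * \<i>) *\<^sub>C g \<omega>" for \<omega>
      unfolding f_def g_def F_def per rcis_minus_2pi polar_log_shift
      by (simp add: scaleC.diff_left scaleC.diff_right scaleC.minus_left scaleC_scaleC algebra_simps)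
    have "integral {\<theta> - 2 * pi..\<phi> - 2 * pi} f = integral {\<theta>..\<phi>} (\<lambda>\<omega>. f (\<omega> - 2 * pi))"
      using integral_shift_real_ivl[of "\<theta> - 2 * pi" "- (2 * pi)" "\<phi> - 2 * pi" f] by simp
    also have "\<dots> = integral {\<theta>..\<phi>} f - (2 * pi * \<i>) *\<^sub>C integral {\<theta>..\<phi>} g"
      unfolding shift using integral_scaleC[OF gi] fi' by (simp add: integral_diff)
    finally show ?thesis .
  qed
  ultimately show ?thesis
    by (simp add: collapse PG scaleC.diff_right scaleC.add_right scaleC.minus_right)
qed

section \<open>Extension by continuity\<close>

lemma continuous_extension_eqI:
  fixes T :: "'h::complex_hilbert_space \<Rightarrow> 'h"
  assumes dense: "densely_defined D" and S: "continuous_on UNIV S" "\<And>x. x \<in> D \<Longrightarrow> S x = T x"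
  shows "continuous_extension D T = S"
  unfolding continuous_extension_def
proof (rule the_equality)
  fix S' assume S': "continuous_on UNIV S' \<and> (\<forall>x\<in>D. S' x = T x)"
  have "closed {y. S' y = S y}" using S' S(1) by (intro closed_Collect_eq) auto
  moreover have "D \<subseteq> {y. S' y = S y}" using S' S(2) by auto
  ultimately have "closure D \<subseteq> {y. S' y = S y}" by (rule closure_minimal[rotated])
  then show "S' = S" using dense by (auto simp: densely_defined_def)
qed (use S in auto)

text \<open>Additivity turns boundedness into Lipschitz continuity on the dense domain, which is what makes
  both extensions exist; the description operator in their definition then picks them out.\<close>

lemma continuous_extension_scaleC:
  fixes T :: "'h::complex_hilbert_space \<Rightarrow> 'h"
  assumes dense: "densely_defined D" and bdd: "bounded_on D T"
    and diff: "\<And>x y. x \<in> D \<Longrightarrow> y \<in> D \<Longrightarrow> x - y \<in> D \<and> T (x - y) = T x - T y"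
    and L: "\<And>x. x \<in> D \<Longrightarrow> L x = c *\<^sub>C T x"
  shows "continuous_extension D L = (\<lambda>y. c *\<^sub>C continuous_extension D T y)"
proof -
  obtain B where B: "\<And>x. x \<in> D \<Longrightarrow> norm (T x) \<le> B * norm x"
    using bdd unfolding bounded_on_def by blast
  have "norm (T x - T y) \<le> \<bar>B\<bar> * norm (x - y)" if "x \<in> D" "y \<in> D" for x y
    using diff[OF that] B[of "x - y"] mult_right_mono[OF abs_ge_self norm_ge_zero, of B "x - y"] by simp
  then have "\<bar>B\<bar>-lipschitz_on D T"
    by (intro lipschitz_onI) (auto simp: dist_norm)
  then have "uniformly_continuous_on D T" by (rule lipschitz_on_uniformly_continuous)
  then obtain S where S: "uniformly_continuous_on (closure D) S" "\<And>x. x \<in> D \<Longrightarrow> T x = S x"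
    by (rule uniformly_continuous_on_extension_on_closure) blast
  then have cS: "continuous_on UNIV S"
    using dense uniformly_continuous_imp_continuous by (auto simp: densely_defined_def)
  have "continuous_extension D T = S"
    using dense cS S(2) by (intro continuous_extension_eqI) auto
  moreover have "continuous_extension D L = (\<lambda>y. c *\<^sub>C S y)"
    using dense cS S(2) L by (intro continuous_extension_eqI scaleC.continuous_on continuous_intros) auto
  ultimately show ?thesis by simp
qed

section \<open>The sectorial projection as a difference of logarithms\<close>

theorem proposition4p4:
  fixes D :: "'h::complex_hilbert_space set" and A :: "'h \<Rightarrow> 'h"
    and \<theta> \<phi> \<delta>\<^sub>1 \<delta>\<^sub>2 r0 :: real
  assumes "clinear_operator D A" and "densely_defined D" and "closed_operator D A"
    and "\<theta> < \<phi>" and "\<phi> < \<theta> + 2 * pi"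
    and "\<delta>\<^sub>1 > 0" and "sector \<theta> \<delta>\<^sub>1 \<subseteq> resolvent_set D A"
    and "\<delta>\<^sub>2 > 0" and "sector \<phi> \<delta>\<^sub>2 \<subseteq> resolvent_set D A"
    and "\<forall>\<mu>\<in>resolvent_set D A. compact_operator (resolvent D A \<mu>)"
    and "\<forall>\<omega>. \<bar>\<omega> - \<theta>\<bar> < \<delta>\<^sub>1 \<longrightarrow>
           (\<lambda>r. onorm (resolvent D A (rcis r \<omega>))) \<in> O[at_top](\<lambda>r. 1 / r)"
    and "\<forall>\<omega>. \<bar>\<omega> - \<phi>\<bar> < \<delta>\<^sub>2 \<longrightarrow>
           (\<lambda>r. onorm (resolvent D A (rcis r \<omega>))) \<in> O[at_top](\<lambda>r. 1 / r)"
    and "r0 > 0" and "\<forall>\<mu>. eigenvalue D A \<mu> \<and> cmod \<mu> \<le> r0 \<longrightarrow> \<mu> = 0"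
  shows "(\<forall>x\<in>D.
            op_log_defined D A r0 \<theta> x \<and> op_log_defined D A r0 \<phi> x \<and>
            polar_contour_integrable r0 \<phi> \<theta> (projection_integrand D A x) \<and>
            op_log D A r0 \<theta> x - op_log D A r0 \<phi> x
              = polar_contour_integral r0 \<phi> \<theta> (projection_integrand D A x) \<and>
            polar_contour_integral r0 \<phi> \<theta> (projection_integrand D A x)
              = (- (2 * pi * \<i>)) *\<^sub>C sectorial_projection D A r0 \<theta> \<phi> x) \<and>
         (bounded_on D (sectorial_projection D A r0 \<theta> \<phi>) \<longrightarrow>
            bounded_on D (\<lambda>x. op_log D A r0 \<theta> x - op_log D A r0 \<phi> x) \<and>
            continuous_extension D (sectorial_projection D A r0 \<theta> \<phi>)
              = (\<lambda>y. (\<i> / (2 * pi)) *\<^sub>C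
                   continuous_extension D (\<lambda>x. op_log D A r0 \<theta> x - op_log D A r0 \<phi> x) y))"
proof -
  note lin = assms(1) and dense = assms(2) and r0 = assms(13)
  have ray: "rcis r \<theta> \<in> resolvent_set D A" "rcis r \<phi> \<in> resolvent_set D A" if "r > 0" for r
    using assms(6-9) that unfolding sector_def by force+
  \<comment> \<open>The circular part of the contours is where the spectrum must be excluded by compactness; the
    rays lie in the given sectors.\<close>
  have circle: "rcis r0 \<omega> \<in> resolvent_set D A" for \<omega>
  proof (rule compact_resolvent_spectrum[OF lin ray(1)[OF zero_less_one]])
    show "compact_operator (resolvent D A (rcis 1 \<theta>))" using assms(10) ray(1) by simp
    show "\<not> eigenvalue D A (rcis r0 \<omega>)"
    proof
      assume "eigenvalue D A (rcis r0 \<omega>)"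
      then have "rcis r0 \<omega> = 0" using assms(14)[rule_format, of "rcis r0 \<omega>"] r0 by simp
      with r0 show False by simp
    qed
  qed
  have spec: "rcis r \<omega> \<in> resolvent_set D A"
    if "(r, \<omega>) \<in> polar_contour r0 \<theta> (\<theta> - 2 * pi) \<or> (r, \<omega>) \<in> polar_contour r0 \<phi> (\<phi> - 2 * pi) \<or>
      (r, \<omega>) \<in> polar_contour r0 \<phi> \<theta>" for r \<omega>
    using that r0 circle ray by (auto simp: polar_contour_def rcis_minus_2pi)
  have bigo: "(\<lambda>r. onorm (resolvent D A (rcis r \<theta>))) \<in> O[at_top](\<lambda>r. 1 / r)"
    "(\<lambda>r. onorm (resolvent D A (rcis r \<phi>))) \<in> O[at_top](\<lambda>r. 1 / r)"
    using assms(6,8,11,12) by simp_all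
  let ?P = "\<lambda>x. polar_contour_integral r0 \<phi> \<theta> (projection_integrand D A x)"
  let ?L = "\<lambda>x. op_log D A r0 \<theta> x - op_log D A r0 \<phi> x"
  have proj: "?P x = (- (2 * pi * \<i>)) *\<^sub>C sectorial_projection D A r0 \<theta> \<phi> x" for x
    by (simp add: sectorial_projection_def scaleC_scaleC)
  have main: "op_log_defined D A r0 \<theta> x \<and> op_log_defined D A r0 \<phi> x \<and>
      polar_contour_integrable r0 \<phi> \<theta> (projection_integrand D A x) \<and> ?L x = ?P x" if x: "x \<in> D" for x
  proof -
    define G where "G r \<omega> = inverse (rcis r \<omega>) *\<^sub>C resolvent D A (rcis r \<omega>) (A x)" for r \<omega>
    have per: "G r (\<omega> - 2 * pi) = G r \<omega>" for r \<omega> by (simp add: G_def rcis_minus_2pi)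
    have G: "polar_contour_integrable r0 \<phi> \<theta> G"
      unfolding G_def by (rule polar_contour_inverse_resolvent(3)[OF lin r0]) (use spec bigo assms(4) in auto)
    have "projection_integrand D A x r \<omega> = G r \<omega>" if "(r, \<omega>) \<in> polar_contour r0 \<phi> \<theta>" for r \<omega>
      using operator_resolvent_commute[OF lin spec x] that by (simp add: projection_integrand_def G_def)
    note PG = polar_contour_cong[OF this]
    note log\<theta> = op_log_on_domain[OF lin r0 x spec bigo(1), folded G_def]
    note log\<phi> = op_log_on_domain[OF lin r0 x spec bigo(2), folded G_def]
    have "?L x = (\<i> / (2 * pi)) *\<^sub>C - ((2 * pi * \<i>) *\<^sub>C polar_contour_integral r0 \<phi> \<theta> G)"
      using polar_contour_log_branch_difference[OF _ _ per G log\<theta>(1) log\<phi>(1)] assms(4,5)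
      by (simp add: log\<theta>(3) log\<phi>(3) flip: scaleC.diff_right)
    also have "\<dots> = polar_contour_integral r0 \<phi> \<theta> G"
      by (simp add: scaleC_scaleC scaleC.minus_left flip: scaleC.minus_right)
    finally show ?thesis using G PG log\<theta>(2) log\<phi>(2) by simp
  qed
  have L: "?L x = (- (2 * pi * \<i>)) *\<^sub>C sectorial_projection D A r0 \<theta> \<phi> x" if "x \<in> D" for x
    using main[OF that] proj[of x] by simp
  have diff: "x - y \<in> D \<and> sectorial_projection D A r0 \<theta> \<phi> (x - y) =
      sectorial_projection D A r0 \<theta> \<phi> x - sectorial_projection D A r0 \<theta> \<phi> y"
    if "x \<in> D" "y \<in> D" for x y
  proof
    have "x + (- 1) *\<^sub>C y \<in> D" using lin that unfolding clinear_operator_def by blast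
    then show "x - y \<in> D" by (simp add: scaleC.minus_left)
    have "projection_integrand D A (x - y) r \<omega> =
        projection_integrand D A x r \<omega> - projection_integrand D A y r \<omega>"
      if "(r, \<omega>) \<in> polar_contour r0 \<phi> \<theta>" for r \<omega>
    proof -
      have \<mu>: "rcis r \<omega> \<in> resolvent_set D A" using spec that by blast
      interpret R: bounded_linear "resolvent D A (rcis r \<omega>)" using \<mu> by (rule bounded_linear_resolvent)
      show ?thesis
        unfolding projection_integrand_def operator_resolvent[OF \<mu>]
        by (simp add: R.diff scaleC.diff_right scaleC.add_right)
    qed
    from polar_contour_cong(2)[OF this] have "?P (x - y) = ?P x - ?P y"
      using polar_contour_diff(2)[of r0 \<phi> \<theta> "projection_integrand D A x" "projection_integrand D A y"] main that
      by simp
    then show "sectorial_projection D A r0 \<theta> \<phi> (x - y) =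
        sectorial_projection D A r0 \<theta> \<phi> x - sectorial_projection D A r0 \<theta> \<phi> y"
      by (simp add: sectorial_projection_def scaleC.diff_right)
  qed
  have "bounded_on D ?L \<and> continuous_extension D (sectorial_projection D A r0 \<theta> \<phi>) =
      (\<lambda>y. (\<i> / (2 * pi)) *\<^sub>C continuous_extension D ?L y)"
    if bdd: "bounded_on D (sectorial_projection D A r0 \<theta> \<phi>)"
  proof
    obtain C where C: "\<And>x. x \<in> D \<Longrightarrow> norm (sectorial_projection D A r0 \<theta> \<phi> x) \<le> C * norm x"
      using bdd unfolding bounded_on_def by blast
    have "norm (?L x) \<le> (2 * pi * C) * norm x" if "x \<in> D" for x
      using C[OF that] by (simp add: L[OF that] norm_scaleC norm_mult)
    then show "bounded_on D ?L" unfolding bounded_on_def by blast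
    show "continuous_extension D (sectorial_projection D A r0 \<theta> \<phi>) =
        (\<lambda>y. (\<i> / (2 * pi)) *\<^sub>C continuous_extension D ?L y)"
    proof -
      have "continuous_extension D ?L =
          (\<lambda>y. (- (2 * pi * \<i>)) *\<^sub>C continuous_extension D (sectorial_projection D A r0 \<theta> \<phi>) y)"
        by (rule continuous_extension_scaleC[OF dense bdd]) (fact diff, fact L)
      then show ?thesis by (simp add: scaleC_scaleC)
    qed
  qed
  then show ?thesis using main proj by blast
qed

end
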